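(* Let $\Delta$ be the Sierpiński triangle. For every $\alpha\in(0,1)$ we have $$D_*(\alpha,\Delta)\le D_{\underline{B}*}(\alpha,\Delta)\le\frac{h^{-1}(\alpha)}{1+h^{-1}(\alpha)},$$ where $$h(t)=\frac{-(1-t)\log_2(1-t)-t\log_2(t)+t}{1+t}$$ on the domain $(0,1/2]$.
   Context: The Sierpiński triangle is $\Delta=\bigcap_{n\ge 0}\Delta_n$, where $\Delta_0$ is a closed equilateral triangle of side length $1$ and $\Delta_n$ is the union of the $3^n$ closed triangles of side length $2^{-n}$ of the $n$th step of the standard construction. The function $h$ maps $(0,1/2]$ bijectively onto $(0,1]$, and $h^{-1}$ is its inverse. For compact $F\subset\mathbb{R}^p$ and $0<\alpha\le1$, $C_1^\alpha(F)$ is the set of $f:F\to\mathbb{R}$ with $|f(a)-f(b)|\le|a-b|^\alpha$ for all $a,b\in F$, with the topology of the supremum norm. For $f:F\to\mathbb{R}$ put $$D_*^f(F)=\sup\{d:\lambda(\{r:\dim_H(f^{-1}(r))\ge d\})>0\},\qquad D_{\underline{B}*}^f(F)=\sup\{d:\lambda(\{r:\underline{\dim}_B(f^{-1}(r))\ge d\})>0\},$$ where $\lambda$ is one-dimensional Lebesgue measure, $\dim_H$ is Hausdorff dimension and $\underline{\dim}_B$ is lower box dimension. Let $\mathfrak{G}_{1,\alpha}(F)$ be the collection of dense $G_\delta$ subsets of $C_1^\alpha(F)$, and $$D_*(\alpha,F)=\sup_{\mathcal{G}\in\mathfrak{G}_{1,\alpha}(F)}\inf\{D_*^f(F): f\in\mathcal{G}\},\qquad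 D_{\underline{B}*}(\alpha,F)=\sup_{\mathcal{G}\in\mathfrak{G}_{1,\alpha}(F)}\inf\{D_{\underline{B}*}^f(F): f\in\mathcal{G}\}.$$ *)

theory Defs
  imports "HOL-Analysis.Analysis" "HOL-Real_Asymp.Real_Asymp"
begin

text \<open>
  The \<open>s\<close>-th power of the diameter with the usual conventions for the Hausdorff measure:
  the empty set contributes \<open>0\<close>, and a nonempty set contributes \<open>1\<close> when \<open>s = 0\<close>
  (whereas \<open>0 powr 0 = 0\<close>). It is only applied to bounded sets, since \<open>diameter\<close> is
  unspecified on unbounded ones.
\<close>

definition diameter_powr :: "real \<Rightarrow> 'a::metric_space set \<Rightarrow> ennreal" where
  "diameter_powr s U =
     (if U = {} then 0 else if s = 0 then 1 else ennreal (diameter U powr s))"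

definition hausdorff_premeasure :: "real \<Rightarrow> real \<Rightarrow> 'a::metric_space set \<Rightarrow> ennreal" where
  "hausdorff_premeasure s \<delta> A =
     (INF U \<in> {U :: nat \<Rightarrow> 'a set. A \<subseteq> (\<Union>i. U i) \<and> (\<forall>i. bounded (U i) \<and> diameter (U i) \<le> \<delta>)}.
        \<Sum>i. diameter_powr s (U i))"

definition hausdorff_measure :: "real \<Rightarrow> 'a::metric_space set \<Rightarrow> ennreal" where
  "hausdorff_measure s A = (SUP \<delta> \<in> {0<..}. hausdorff_premeasure s \<delta> A)"

definition hausdorff_dim :: "'a::metric_space set \<Rightarrow> ereal" where
  "hausdorff_dim A = Inf {ereal s | s. 0 \<le> s \<and> hausdorff_measure s A = 0}"

text \<open>
  The least number of sets of diameter at most \<open>\<delta>\<close> that cover \<open>A\<close>; meaningful for totally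
  bounded \<open>A\<close>, in particular for the subsets of a compact set.
\<close>

definition covering_number :: "real \<Rightarrow> 'a::metric_space set \<Rightarrow> nat" where
  "covering_number \<delta> A =
     (LEAST n. \<exists>C. finite C \<and> card C = n \<and> A \<subseteq> \<Union>C \<and> (\<forall>U\<in>C. bounded U \<and> diameter U \<le> \<delta>))"

text \<open>
  Both dimensions of the empty set are \<open>0\<close>; for the box dimension this uses \<open>ln 0 = 0\<close>.
\<close>

definition lower_box_dim :: "'a::metric_space set \<Rightarrow> ereal" where
  "lower_box_dim A =
     Liminf (at_right 0) (\<lambda>\<delta>. ereal (ln (real (covering_number \<delta> A)) / (- ln \<delta>)))"

text \<open>
  Functions \<open>F \<rightarrow> \<real>\<close> are represented by total functions that are \<open>undefined\<close> outside \<open>F\<close>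
  (membership in \<open>extensional F\<close> is part of \<open>cfunspace\<close>), and the distance is the
  supremum distance over \<open>F\<close>. For compact \<open>F\<close> and \<open>\<alpha> > 0\<close>, the continuity and boundedness
  required by \<open>cfunspace\<close> follow from the Hoelder
  condition, see \<open>mspace_holder_space\<close>.
\<close>

definition holder_space :: "real \<Rightarrow> 'a::euclidean_space set \<Rightarrow> ('a \<Rightarrow> real) metric" where
  "holder_space \<alpha> F =
     submetric (cfunspace (top_of_set F) euclidean_metric)
       {f. \<forall>a\<in>F. \<forall>b\<in>F. \<bar>f a - f b\<bar> \<le> dist a b powr \<alpha>}"

lemma mspace_holder_space:
  fixes F :: "'a::euclidean_space set"
  assumes "compact F" "0 < \<alpha>"
  shows "mspace (holder_space \<alpha> F) =
           {f \<in> extensional F. \<forall>a\<in>F. \<forall>b\<in>F. \<bar>f a - f b\<bar> \<le> dist a b powr \<alpha>}"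
proof -
  have "continuous_on F f" if f: "\<forall>a\<in>F. \<forall>b\<in>F. \<bar>f a - f b\<bar> \<le> dist a b powr \<alpha>" for f
    unfolding continuous_on_def
  proof
    fix a assume a: "a \<in> F"
    have "((\<lambda>b. dist b a powr \<alpha>) \<longlongrightarrow> 0 powr \<alpha>) (at a within F)"
      using \<open>0 < \<alpha>\<close> by (intro tendsto_powr' tendsto_const) (auto simp flip: tendsto_dist_iff)
    then have lim: "((\<lambda>b. dist b a powr \<alpha>) \<longlongrightarrow> 0) (at a within F)"
      using \<open>0 < \<alpha>\<close> by simp
    have "eventually (\<lambda>b. norm (f b - f a) \<le> dist b a powr \<alpha>) (at a within F)"
      using f a by (simp add: eventually_at_filter)
    then have "((\<lambda>b. f b - f a) \<longlongrightarrow> 0) (at a within F)"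
      using lim by (rule Lim_null_comparison)
    then show "(f \<longlongrightarrow> f a) (at a within F)"
      by (simp add: LIM_zero_iff)
  qed
  moreover have "bounded (f ` F)" if "continuous_on F f" for f :: "'a \<Rightarrow> real"
    using compact_imp_bounded[OF compact_continuous_image[OF that \<open>compact F\<close>]] .
  ultimately show ?thesis
    unfolding holder_space_def mspace_submetric mspace_cfunspace by auto
qed

definition dense_gdeltas :: "real \<Rightarrow> 'a::euclidean_space set \<Rightarrow> ('a \<Rightarrow> real) set set" where
  "dense_gdeltas \<alpha> F =
     {G. gdelta_in (mtopology_of (holder_space \<alpha> F)) G \<and>
         mtopology_of (holder_space \<alpha> F) closure_of G = mspace (holder_space \<alpha> F)}"

text \<open>
  The Lebesgue outer measure is used so that the definition does not depend on the
  measurability of the set of levels (\<open>emeasure\<close> is \<open>0\<close> on nonmeasurable sets); on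
  measurable sets it is the Lebesgue measure.
\<close>

definition level_dim :: "('a set \<Rightarrow> ereal) \<Rightarrow> ('a \<Rightarrow> real) \<Rightarrow> 'a::euclidean_space set \<Rightarrow> ereal" where
  "level_dim d_set f F =
     Sup {ereal d | d. 0 < outer_measure_of lborel {r. d_set {x \<in> F. f x = r} \<ge> ereal d}}"

definition generic_level_dim :: "('a set \<Rightarrow> ereal) \<Rightarrow> real \<Rightarrow> 'a::euclidean_space set \<Rightarrow> ereal" where
  "generic_level_dim d_set \<alpha> F = (SUP G \<in> dense_gdeltas \<alpha> F. INF f \<in> G. level_dim d_set f F)"

definition D_star :: "real \<Rightarrow> 'a::euclidean_space set \<Rightarrow> ereal" where
  "D_star \<alpha> F = generic_level_dim hausdorff_dim \<alpha> F"

definition D_lower_box_star :: "real \<Rightarrow> 'a::euclidean_space set \<Rightarrow> ereal" where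
  "D_lower_box_star \<alpha> F = generic_level_dim lower_box_dim \<alpha> F"

text \<open>
  A closed triangle is encoded by the triple of its vertices. \<open>sierpinski_triples T n\<close> are the
  $3^n$ triangles of the $n$th step of the construction that starts from \<open>T\<close>.
\<close>

fun corner_triangles :: "'a \<times> 'a \<times> 'a \<Rightarrow> ('a::real_vector \<times> 'a \<times> 'a) set" where
  "corner_triangles (a, b, c) =
     {(a, midpoint a b, midpoint a c),
      (midpoint a b, b, midpoint b c),
      (midpoint a c, midpoint b c, c)}"

primrec sierpinski_triples :: "'a::real_vector \<times> 'a \<times> 'a \<Rightarrow> nat \<Rightarrow> ('a \<times> 'a \<times> 'a) set" where
  "sierpinski_triples T 0 = {T}"
| "sierpinski_triples T (Suc n) = (\<Union>S \<in> sierpinski_triples T n. corner_triangles S)"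

definition sierpinski_level :: "'a::real_vector \<Rightarrow> 'a \<Rightarrow> 'a \<Rightarrow> nat \<Rightarrow> 'a set" where
  "sierpinski_level a b c n = (\<Union>(u, v, w) \<in> sierpinski_triples (a, b, c) n. convex hull {u, v, w})"

definition sierpinski_triangle :: "'a::real_vector \<Rightarrow> 'a \<Rightarrow> 'a \<Rightarrow> 'a set" where
  "sierpinski_triangle a b c = (\<Inter>n. sierpinski_level a b c n)"

definition sierpinski_h :: "real \<Rightarrow> real" where
  "sierpinski_h t = (- (1 - t) * log 2 (1 - t) - t * log 2 t + t) / (1 + t)"

definition sierpinski_h_inv :: "real \<Rightarrow> real" where
  "sierpinski_h_inv = the_inv_into {0<..1/2} sierpinski_h"

lemma bij_betw_sierpinski_h: "bij_betw sierpinski_h {0<..1/2} {0<..1}"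
proof -
  define N where "N t = - (1 - t) * ln (1 - t) - t * ln t + t * ln 2" for t :: real
  have h_eq: "sierpinski_h t = N t / (ln 2 * (1 + t))" for t
  proof -
    have "- (1 - t) * log 2 (1 - t) - t * log 2 t + t = N t / ln 2"
      by (simp add: N_def log_def diff_divide_distrib add_divide_distrib)
    then show ?thesis
      by (simp add: sierpinski_h_def)
  qed
  define k where "k t = (ln (1 - t) - ln t + ln 2) * (1 + t) - N t" for t :: real
  have k_deriv: "(k has_real_derivative - (1 / (1 - t) + 1 / t) * (1 + t)) (at t)"
    if "0 < t" "t < 1" for t
    unfolding k_def N_def using that
    by (auto intro!: derivative_eq_intros simp: field_simps)
  have k_half: "k (1/2) = 0"
    by (simp add: k_def N_def ln_div)
  have k_pos: "0 < k t" if "0 < t" "t < 1/2" for t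
  proof -
    have "k t > k (1/2)"
    proof (rule DERIV_neg_imp_decreasing[of t "1/2" k])
      show "t < 1/2" using that by simp
      fix x assume x: "t \<le> x" "x \<le> 1/2"
      have "0 < 1 / (1 - x) + 1 / x"
        using x that by (intro add_pos_pos) auto
      then have "- (1 / (1 - x) + 1 / x) * (1 + x) < 0"
        using x that by (intro mult_neg_pos) linarith+
      then show "\<exists>y. DERIV k x :> y \<and> y < 0"
        using k_deriv[of x] x that by (intro exI[of _ "- (1 / (1 - x) + 1 / x) * (1 + x)"]) auto
    qed
    then show ?thesis using k_half by simp
  qed
  have N_deriv: "(N has_real_derivative (ln (1 - t) - ln t + ln 2)) (at t)"
    if "0 < t" "t < 1" for t
    unfolding N_def using that
    by (auto intro!: derivative_eq_intros simp: divide_simps) (simp_all add: algebra_simps)?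
  have h_deriv: "(sierpinski_h has_real_derivative k t / (ln 2 * (1 + t)^2)) (at t)"
    if "0 < t" "t < 1" for t
  proof -
    have "((\<lambda>t. N t / (ln 2 * (1 + t))) has_real_derivative
            ((ln (1 - t) - ln t + ln 2) * (ln 2 * (1 + t)) - N t * ln 2)
              / ((ln 2 * (1 + t)) * (ln 2 * (1 + t)))) (at t)"
    proof (rule DERIV_divide)
      show "(N has_real_derivative (ln (1 - t) - ln t + ln 2)) (at t)"
        using N_deriv that by simp
      show "((\<lambda>t. ln 2 * (1 + t)) has_real_derivative ln 2) (at t)"
        by (auto intro!: derivative_eq_intros)
      show "ln 2 * (1 + t) \<noteq> 0" using that by simp
    qed
    moreover have "((ln (1 - t) - ln t + ln 2) * (ln 2 * (1 + t)) - N t * ln 2)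
              / ((ln 2 * (1 + t)) * (ln 2 * (1 + t))) = k t / (ln 2 * (1 + t)^2)"
    proof -
      have "(ln (1 - t) - ln t + ln 2) * (ln 2 * (1 + t)) - N t * ln 2 = ln 2 * k t"
        by (simp add: k_def algebra_simps)
      then show ?thesis using that by (simp add: power2_eq_square)
    qed
    ultimately show ?thesis
      by (simp add: h_eq[abs_def])
  qed
  have cont: "continuous_on {0<..1/2} sierpinski_h"
    by (intro continuous_at_imp_continuous_on ballI)
       (use h_deriv in \<open>force intro: DERIV_isCont\<close>)
  have mono: "sierpinski_h s < sierpinski_h t" if "0 < s" "s < t" "t \<le> 1/2" for s t
  proof (rule DERIV_pos_imp_increasing_open[of s t sierpinski_h])
    show "s < t" by fact
    fix x assume "s < x" "x < t"
    then show "\<exists>y. DERIV sierpinski_h x :> y \<and> y > 0"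
      using h_deriv[of x] k_pos[of x] that
      by (intro exI[of _ "k x / (ln 2 * (1 + x)^2)"] conjI divide_pos_pos mult_pos_pos) auto
  next
    show "continuous_on {s..t} sierpinski_h"
      by (rule continuous_on_subset[OF cont]) (use that in auto)
  qed
  have h_half: "sierpinski_h (1/2) = 1"
    by (simp add: sierpinski_h_def log_divide)
  have h_pos: "0 < sierpinski_h t" if "0 < t" "t \<le> 1/2" for t
  proof -
    have "log 2 (1 - t) < 0" "log 2 t < 0" using that by auto
    then have "(1 - t) * log 2 (1 - t) < 0" "t * log 2 t < 0"
      using that by (auto simp: mult_pos_neg)
    then show ?thesis using that unfolding sierpinski_h_def mult_minus_left
      by (intro divide_pos_pos) linarith+
  qed
  have lim: "((\<lambda>t. sierpinski_h t) \<longlongrightarrow> 0) (at_right 0)"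
    unfolding sierpinski_h_def by real_asymp
  have surj: "\<exists>t\<in>{0<..1/2}. sierpinski_h t = y" if y: "0 < y" "y \<le> 1" for y
  proof -
    have "eventually (\<lambda>t. sierpinski_h t < y) (at_right 0)"
      using order_tendstoD(2)[OF lim] y by simp
    moreover have "eventually (\<lambda>t::real. t < 1/2) (at_right 0)"
      by (auto simp: eventually_at_right_field intro!: exI[of _ "1/2"])
    moreover have "eventually (\<lambda>t::real. 0 < t) (at_right 0)"
      by (simp add: eventually_at_right_less)
    ultimately have "eventually (\<lambda>t. sierpinski_h t < y \<and> t < 1/2 \<and> 0 < t) (at_right 0)"
      by eventually_elim auto
    then obtain s where s: "sierpinski_h s < y" "s < 1/2" "0 < s"
      using eventually_happens'[OF trivial_limit_at_right_real] by blast
    have "\<exists>x\<ge>s. x \<le> 1/2 \<and> sierpinski_h x = y"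
      by (rule IVT') (use s y h_half in \<open>auto intro: continuous_on_subset[OF cont]\<close>)
    then show ?thesis using s by force
  qed
  show ?thesis
    unfolding bij_betw_def
  proof
    show "inj_on sierpinski_h {0<..1/2}"
      by (rule linorder_inj_onI) (use mono in force)+
    have h_le: "sierpinski_h t \<le> 1" if "0 < t" "t \<le> 1/2" for t
      using mono[of t "1/2"] that h_half by (metis order.refl order.strict_iff_order)
    show "sierpinski_h ` {0<..1/2} = {0<..1}"
    proof (intro equalityI subsetI)
      fix y assume "y \<in> sierpinski_h ` {0<..1/2}"
      then obtain t where "y = sierpinski_h t" "0 < t" "t \<le> 1/2"
        by (elim imageE) (simp only: greaterThanAtMost_iff)
      then show "y \<in> {0<..1}"
        using h_le h_pos by (simp only: greaterThanAtMost_iff)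
    next
      fix y :: real assume "y \<in> {0<..1}"
      then show "y \<in> sierpinski_h ` {0<..1/2}"
        using surj[of y] by (simp only: greaterThanAtMost_iff image_iff) metis
    qed
  qed
qed

end

theory Submission
  imports Defs
begin

text \<open>
  By the Baire category theorem it suffices to find, near any given function of the space, a
  function \<open>f\<close> that has, at one fine scale \<open>2^(-N)\<close>, level sets meeting at most
  \<open>2^(N (\<beta> + \<epsilon>))\<close> cells, for all levels outside a set of measure below \<open>\<epsilon>\<close> and stably under small
  perturbations; almost every level set of a generic function is then frugal at infinitely
  many scales.

  Such an \<open>f\<close> has the values of a slightly contracted Lipschitz approximation at the vertices of
  the cells of a level \<open>m\<close> and is continued to finer vertices by two rules. In a cell with vertex
  values \<open>x < y < z\<close> all midpoints get the value \<open>y\<close>, which leaves the two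
  nonconstant cells \<open>(x, y, y)\<close> and \<open>(y, y, z)\<close>, and each level meets only one of them. In a cell with
  values \<open>(x, x, z)\<close> and range of length \<open>\<rho> = \<bar>z - x\<bar>\<close>, a fraction \<open>v\<close> of the levels goes down to
  two cells, each of which is split by the first rule into two cells of range \<open>v \<rho> / 2\<close>, and the
  others go up to one cell of range \<open>(1 - v) \<rho>\<close>. If \<open>v\<close> is the ratio of the remaining downs
  to the remaining moves, all words with \<open>k\<close> downs and \<open>n - k\<close> ups end in
  cells of the same range, smaller by the factor \<open>2^k (n choose k)\<close> after \<open>n + k\<close> levels, and
  each level meets \<open>2^k\<close> of them. For \<open>k / n \<approx> t\<close> the resulting Hoelder exponent tends to \<open>h(t)\<close>,
  and the dimension of the level sets is \<open>t / (1 + t)\<close>. A Lipschitz function has so small an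
  oscillation on fine cells that the constants lost in the construction are absorbed by \<open>2^(m (1 - \<alpha>))\<close>.
\<close>

section \<open>The midpoint rule\<close>

definition lo3 :: "real \<Rightarrow> real \<Rightarrow> real \<Rightarrow> real" where "lo3 x y z = min x (min y z)"
definition hi3 :: "real \<Rightarrow> real \<Rightarrow> real \<Rightarrow> real" where "hi3 x y z = max x (max y z)"
definition med3 :: "real \<Rightarrow> real \<Rightarrow> real \<Rightarrow> real" where
  "med3 x y z = max (min x y) (min (max x y) z)"
text \<open>The larger gap between neighbours in the sorted triple. It behaves better than the range
  under both rules: for three different values it is the larger range of the two nonconstant
  children, and for two equal values it is the range itself.\<close>

definition gap3 :: "real \<Rightarrow> real \<Rightarrow> real \<Rightarrow> real" where
  "gap3 x y z = max (hi3 x y z - med3 x y z) (med3 x y z - lo3 x y z)"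
definition dist3 :: "real \<Rightarrow> real \<Rightarrow> real \<Rightarrow> bool" where
  "dist3 x y z \<longleftrightarrow> x \<noteq> y \<and> y \<noteq> z \<and> x \<noteq> z"

text \<open>
  The value at the midpoint of the edge with end values \<open>x\<close>, \<open>y\<close>, where \<open>z\<close> is the value at the
  opposite vertex. If exactly two of the three values agree and the edge joins different ones,
  then \<open>z\<close> is the repeated value and \<open>x + y - z\<close> the other one.
\<close>

definition edge_val :: "real \<Rightarrow> real \<Rightarrow> real \<Rightarrow> real \<Rightarrow> real" where
  "edge_val v x y z =
     (if dist3 x y z then med3 x y z
      else if x = y then x + v / 2 * (z - x)
      else z + v * (x + y - 2 * z))"

text \<open>
  The state of a cell counts the downs left in the current block; this is the state of the child at
  the corner with value \<open>x\<close>.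
\<close>

definition child_state :: "nat \<Rightarrow> real \<Rightarrow> real \<Rightarrow> real \<Rightarrow> nat" where
  "child_state s x y z = (if dist3 x y z \<or> y = z then s else s - 1)"

lemmas triple_defs = lo3_def hi3_def med3_def gap3_def dist3_def

lemma edge_val_commute: "edge_val v x y z = edge_val v y x z"
  by (auto simp: edge_val_def triple_defs min_def max_def)

lemma gap3_perm: "gap3 x y z = gap3 y x z" "gap3 x y z = gap3 x z y"
  by (auto simp: triple_defs min_def max_def)

lemma lo3_perm: "lo3 x y z = lo3 y x z" "lo3 x y z = lo3 x z y"
  by (auto simp: lo3_def min_def)

lemma hi3_perm: "hi3 x y z = hi3 y x z" "hi3 x y z = hi3 x z y"
  by (auto simp: hi3_def max_def)

lemma dist3_perm: "dist3 x y z = dist3 y x z" "dist3 x y z = dist3 x z y"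
  by (auto simp: dist3_def)

lemma range_le_gap3: "hi3 x y z - lo3 x y z \<le> 2 * gap3 x y z"
  by (auto simp: triple_defs min_def max_def)

lemma med3_between: "lo3 x y z \<le> med3 x y z" "med3 x y z \<le> hi3 x y z"
  by (auto simp: triple_defs)

lemma gap3_pair [simp]: "gap3 x m m = \<bar>x - m\<bar>"
  by (auto simp: triple_defs min_def max_def)

lemma gap3_arith: "gap3 x (x + d) (x + 2 * d) = \<bar>d\<bar>"
  by (auto simp: triple_defs min_def max_def)

lemma gap3_dist_med: "\<bar>x - med3 x y z\<bar> \<le> gap3 x y z"
  by (auto simp: triple_defs min_def max_def)

lemma convex_comb_between:
  fixes s t v :: real
  assumes "0 \<le> v" "v \<le> 1"
  shows "min s t \<le> s + v * (t - s)" "s + v * (t - s) \<le> max s t"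
proof -
  have "(s + v * (t - s)) \<in> closed_segment s t"
    using assms by (auto simp: closed_segment_def intro!: exI[of _ v]) (simp add: algebra_simps)
  then show "min s t \<le> s + v * (t - s)" "s + v * (t - s) \<le> max s t"
    by (auto simp: closed_segment_eq_real_ivl split: if_splits)
qed

text \<open>Every new value is a vertex value, the median, or a convex combination of two vertex
  values. In a constant cell \<open>v\<close> is arbitrary, but it only multiplies zero.\<close>

lemma edge_val_between:
  assumes "x = y \<and> y = z \<or> 0 \<le> v \<and> v \<le> 1"
  shows "lo3 x y z \<le> edge_val v x y z" "edge_val v x y z \<le> hi3 x y z"
proof -
  consider "x = y \<and> y = z" | "dist3 x y z" | "x = y" "y \<noteq> z" "0 \<le> v \<and> v \<le> 1"
    | "x \<noteq> y" "x = z" "0 \<le> v \<and> v \<le> 1" | "x \<noteq> y" "y = z" "0 \<le> v \<and> v \<le> 1"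
    using assms by (auto simp: dist3_def)
  then have "lo3 x y z \<le> edge_val v x y z \<and> edge_val v x y z \<le> hi3 x y z"
  proof cases
    case 1 then show ?thesis by (auto simp: edge_val_def triple_defs)
  next
    case 2 then show ?thesis by (simp add: edge_val_def med3_between)
  next
    case 3
    have "edge_val v x y z = x + v/2 * (z - x)" using 3 by (simp add: edge_val_def dist3_def)
    then show ?thesis using convex_comb_between[of "v/2" x z] 3 by (auto simp: lo3_def hi3_def)
  next
    case 4
    have "edge_val v x y z = z + v * (y - z)" using 4 by (simp add: edge_val_def dist3_def)
    then show ?thesis using convex_comb_between[of v z y] 4 by (auto simp: lo3_def hi3_def)
  next
    case 5
    have "edge_val v x y z = z + v * (x - z)" using 5 by (simp add: edge_val_def dist3_def)
    then show ?thesis using convex_comb_between[of v z x] 5 by (auto simp: lo3_def hi3_def)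
  qed
  then show "lo3 x y z \<le> edge_val v x y z" "edge_val v x y z \<le> hi3 x y z" by auto
qed

section \<open>The range of a cell against its remaining levels\<close>

text \<open>
  The invariant of a cell with \<open>u\<close> levels and \<open>s\<close> downs left in its block. Ups take one level and
  downs two, so that \<open>u - s\<close> moves remain; a cell with three different values
  still needs one level to complete the move that produced it.
\<close>

definition budget :: "nat \<Rightarrow> nat \<Rightarrow> real \<Rightarrow> real \<Rightarrow> real \<Rightarrow> real \<Rightarrow> bool" where
  "budget u s H x y z \<longleftrightarrow>
     gap3 x y z \<le> H * 2 ^ s * real ((u - s - of_bool (dist3 x y z)) choose s) \<and>
     (x = y \<and> y = z \<or> 2 * s + of_bool (dist3 x y z) \<le> u)"

lemma budget_perm: "budget u s H x y z = budget u s H y x z" "budget u s H x y z = budget u s H x z y"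
  unfolding budget_def
  using gap3_perm[of x y z] dist3_perm[of x y z] by auto

definition ratio :: "nat \<Rightarrow> nat \<Rightarrow> real" where "ratio u s = real s / real (u - s)"

lemma ratio_bounds: "2 * s \<le> u \<Longrightarrow> 0 \<le> ratio u s \<and> ratio u s \<le> 1"
  by (auto simp: ratio_def divide_simps)

lemma budget_ratio: "budget u s H x y z \<Longrightarrow> x = y \<and> y = z \<or> 0 \<le> ratio u s \<and> ratio u s \<le> 1"
  using ratio_bounds[of s u] by (auto simp: budget_def)

text \<open>With \<open>v = s / n\<close>, an up shrinks the range by \<open>1 - v\<close> and a
  down by \<open>v / 2\<close>. This identity and the next one show that this choice of
  \<open>v\<close> leaves exactly the binomial coefficient of the remaining moves in either
  case.\<close>

lemma choose_absorb_up:
  assumes "n > 0"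
  shows "(1 - real s / real n) * real (n choose s) = real ((n - 1) choose s)"
proof (cases "s \<le> n")
  case True
  have "(n - s) * (n choose s) = n * ((n - 1) choose s)"
    by (rule binomial_absorb_comp)
  then have "real (n - s) * real (n choose s) = real n * real ((n - 1) choose s)"
    by (metis of_nat_mult)
  then show ?thesis using assms True by (simp add: of_nat_diff field_simps)
qed (use assms in \<open>simp add: binomial_eq_0\<close>)

lemma choose_absorb_down:
  assumes "n > 0" "s > 0"
  shows "real s / real n * real (n choose s) = real ((n - 1) choose (s - 1))"
proof -
  obtain s' where s: "s = Suc s'" using assms by (cases s) auto
  have "Suc s' * (n choose Suc s') = n * ((n - 1) choose s')"
    by (rule binomial_absorption)
  then have "real s * real (n choose s) = real n * real ((n - 1) choose (s - 1))"
    by (metis of_nat_mult s diff_Suc_1)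
  then show ?thesis using assms by (simp add: field_simps)
qed

lemma budget_const: "0 \<le> H \<Longrightarrow> budget u s H x x x"
  by (simp add: budget_def)

lemma budget_apex:
  assumes "budget (Suc u) s H x z z" "x \<noteq> z" "m = z + ratio (Suc u) s * (x - z)" "0 \<le> H"
  shows "budget u s H x m m"
proof -
  define n where "n = Suc u - s"
  have s: "2 * s \<le> Suc u" and g: "\<bar>x - z\<bar> \<le> H * 2 ^ s * real (n choose s)"
    using assms by (auto simp: budget_def dist3_def n_def)
  have n: "n > 0" using s by (auto simp: n_def)
  have v: "ratio (Suc u) s = real s / real n" by (simp add: ratio_def n_def)
  have v1: "real s / real n \<le> 1" using s n by (auto simp: n_def divide_simps)
  have xm: "x - m = (1 - real s / real n) * (x - z)"
    using assms v by (simp add: algebra_simps)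
  have "\<bar>x - m\<bar> = (1 - real s / real n) * \<bar>x - z\<bar>"
    unfolding xm using v1 by (simp add: abs_mult)
  also have "\<dots> \<le> (1 - real s / real n) * (H * 2 ^ s * real (n choose s))"
    by (intro mult_left_mono g) (use v1 in simp)
  also have "\<dots> = H * 2 ^ s * ((1 - real s / real n) * real (n choose s))" by simp
  also have "\<dots> = H * 2 ^ s * real ((u - s) choose s)"
    unfolding choose_absorb_up[OF n] using s by (cases "s \<le> u") (auto simp: n_def Suc_diff_le)
  finally have 1: "\<bar>x - m\<bar> \<le> H * 2 ^ s * real ((u - s) choose s)" .
  \<comment> \<open>The level count passes from \<open>Suc u\<close> to \<open>u\<close> unless all
    remaining moves are downs; then \<open>v = 1\<close> and the apex cell is constant.\<close>
  have "x = m \<or> 2 * s \<le> u"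
  proof (cases "real s / real n = 1")
    case True then show ?thesis using xm by simp
  next
    case False
    then have "s \<noteq> n" using n by auto
    then show ?thesis using s unfolding n_def by arith
  qed
  with 1 show ?thesis by (auto simp: budget_def dist3_def)
qed

lemma budget_base:
  assumes "budget (Suc u) s H x x z" "x \<noteq> z" "0 \<le> H"
    "d = ratio (Suc u) s / 2 * (z - x)"
  shows "budget u (s - 1) H x (x + d) (x + 2 * d)"
proof (cases "s = 0")
  \<comment> \<open>Without downs left \<open>v = 0\<close> and the corner cell is constant, so the
    truncated \<open>s - 1 = 0\<close> does no harm.\<close>
  case True
  then have "d = 0" using assms by (simp add: ratio_def)
  then show ?thesis using assms by (simp add: budget_const)
next
  case False
  define n where "n = Suc u - s"
  have s: "2 * s \<le> Suc u" and g: "\<bar>z - x\<bar> \<le> H * 2 ^ s * real (n choose s)"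
    using assms gap3_perm(1)[of x x z] gap3_perm[of z x x] gap3_perm[of x z x]
    by (auto simp: budget_def dist3_def n_def)
  have n: "n > 0" using s by (auto simp: n_def)
  have v: "ratio (Suc u) s = real s / real n" by (simp add: ratio_def n_def)
  have "\<bar>d\<bar> = real s / real n * \<bar>z - x\<bar> / 2"
    using assms(4) v by (simp add: abs_mult)
  also have "\<dots> \<le> real s / real n * (H * 2 ^ s * real (n choose s)) / 2"
    by (intro divide_right_mono mult_left_mono g) auto
  also have "\<dots> = H * 2 ^ (s - 1) * (real s / real n * real (n choose s))"
    using False by (cases s) auto
  also have "\<dots> = H * 2 ^ (s - 1) * real ((u - s) choose (s - 1))"
    using choose_absorb_down[OF n] False s by (simp add: n_def Suc_diff_le)
  finally have 1: "\<bar>d\<bar> \<le> H * 2 ^ (s - 1) * real ((u - s) choose (s - 1))" .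
  have "d \<noteq> 0" using assms v False n by simp
  then have D: "dist3 x (x + d) (x + 2 * d)" by (auto simp: dist3_def)
  \<comment> \<open>The corner cell carries an arithmetic progression, so \<open>of_bool\<close> is
    \<open>1\<close> in its budget. It makes up for the down just spent:
    \<open>u - (s - 1) - 1 = u - s\<close>.\<close>
  show ?thesis unfolding budget_def gap3_arith using D 1 False s by (cases s) auto
qed

text \<open>Only the corner with value \<open>x\<close> is treated, the others follow by symmetry.
  It belongs to a cell with three different values (d), is the apex (a), or is an end of the base
  (b, b').\<close>

lemma budget_child:
  assumes B: "budget (Suc u) s H x y z" and H: "0 \<le> H"
  defines "v \<equiv> ratio (Suc u) s"
  shows "budget u (child_state s x y z) H x (edge_val v x y z) (edge_val v x z y)"
proof -
  consider (c) "x = y" "y = z" | (d) "dist3 x y z" | (a) "y = z" "x \<noteq> z" | (b) "x = y" "x \<noteq> z"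
    | (b') "x = z" "x \<noteq> y"
    by (auto simp: dist3_def)
  then show ?thesis
  proof cases
    case c
    then show ?thesis using H by (simp add: edge_val_def dist3_def budget_const)
  next
    case d
    have d': "dist3 x z y" using d dist3_perm by blast
    have m: "med3 x z y = med3 x y z" by (auto simp: triple_defs min_def max_def)
    have "budget u s H x (med3 x y z) (med3 x y z)"
      using B d gap3_dist_med[of x y z] unfolding budget_def
      by (auto simp: dist3_def)
    then show ?thesis using d d' m by (simp add: edge_val_def child_state_def)
  next
    case a
    then show ?thesis
      using budget_apex[of u s H x z "z + v * (x - z)"] B H
      by (simp add: edge_val_def child_state_def dist3_def v_def)
  next
    case b
    have "budget u (s - 1) H x (x + v/2 * (z - x)) (x + 2 * (v/2 * (z - x)))"
      using b B H by (intro budget_base) (auto simp: v_def)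
    moreover have "x + 2 * (v/2 * (z - x)) = x + v * (z - x)" by simp
    ultimately show ?thesis using b
      by (simp add: edge_val_def child_state_def dist3_def)
  next
    case b'
    have B': "budget (Suc u) s H x x y" using B b' budget_perm by metis
    have "budget u (s - 1) H x (x + v/2 * (y - x)) (x + 2 * (v/2 * (y - x)))"
      using b' B' H by (intro budget_base) (auto simp: v_def)
    then have "budget u (s - 1) H x (x + 2 * (v/2 * (y - x))) (x + v/2 * (y - x)) "
      using budget_perm by metis
    moreover have "x + 2 * (v/2 * (y - x)) = x + v * (y - x)" by simp
    ultimately show ?thesis using b'
      by (simp add: edge_val_def child_state_def dist3_def)
  qed
qed

section \<open>Counting the cells that a level meets\<close>

text \<open>
  A cell whose range contains \<open>r\<close> counts with the number of cells at the end of the block that will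
  contain \<open>r\<close> in their ranges.
\<close>

definition weight :: "real \<Rightarrow> nat \<Rightarrow> real \<Rightarrow> real \<Rightarrow> real \<Rightarrow> nat" where
  "weight r s x y z = (if lo3 x y z < r \<and> r < hi3 x y z then 2 ^ s else 0)"

lemma weight_perm: "weight r s x y z = weight r s y x z" "weight r s x y z = weight r s x z y"
  unfolding weight_def using lo3_perm[of x y z] hi3_perm[of x y z] by auto

lemma weight_const [simp]: "weight r s x x x = 0"
  by (simp add: weight_def lo3_def hi3_def)

text \<open>The value \<open>m\<close> cuts the range in two. Levels between \<open>m\<close> and
  \<open>x\<close> meet only the apex cell, and levels between \<open>z\<close> and \<open>m\<close>
  meet both base cells, each of half the weight. For \<open>s = 0\<close> the base cells are
  constant and weigh nothing.\<close>

lemma weight_children_isosceles: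
  assumes s: "2 * s \<le> u" and z: "x \<noteq> z"
  defines "v \<equiv> ratio u s"
  defines "m \<equiv> z + v * (x - z)"
  defines "m' \<equiv> z + v / 2 * (x - z)"
  shows "weight r s x m m + weight r (s - 1) z m m' + weight r (s - 1) z m m' \<le> weight r s x z z"
proof -
  have v: "0 \<le> v" "v \<le> 1" using ratio_bounds[OF s] by (auto simp: v_def)
  have m: "min z x \<le> m" "m \<le> max z x" using convex_comb_between[of v z x] v by (auto simp: m_def)
  have m': "min z m \<le> m'" "m' \<le> max z m"
    using convex_comb_between[of "1/2" z m] by (auto simp: m_def m'_def)
  show ?thesis
  proof (cases "s = 0")
    case True
    then have "m = z" "m' = z" by (auto simp: m_def m'_def v_def ratio_def)
    then show ?thesis using True by simp
  next
    case False
    then obtain s' where s': "s = Suc s'" by (cases s) auto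
    have w: "weight r (s - 1) z m m' = (if min z m < r \<and> r < max z m then 2 ^ s' else 0)"
      using m' s' by (auto simp: weight_def lo3_def hi3_def)
    show ?thesis unfolding w using m s'
      by (auto simp: weight_def lo3_def hi3_def split: if_splits)
  qed
qed

text \<open>For three different values the two nonconstant children lie on either side of the
  median, so their open ranges are disjoint. The other cases reduce to the isosceles one.\<close>

lemma weight_children:
  assumes "x = y \<and> y = z \<or> 2 * s \<le> u"
  defines "v \<equiv> ratio u s"
  shows "weight r (child_state s x y z) x (edge_val v x y z) (edge_val v x z y)
       + weight r (child_state s y x z) y (edge_val v y x z) (edge_val v y z x)
       + weight r (child_state s z x y) z (edge_val v z x y) (edge_val v z y x)
       \<le> weight r s x y z"
proof -
  consider (c) "x = y" "y = z" | (d) "dist3 x y z" | (a) "y = z" "x \<noteq> z" | (b) "x = y" "x \<noteq> z"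
    | (b') "x = z" "x \<noteq> y"
    by (auto simp: dist3_def)
  then show ?thesis
  proof cases
    case c
    then show ?thesis by (simp add: edge_val_def dist3_def)
  next
    case d
    then have d': "dist3 x z y" "dist3 y x z" "dist3 y z x" "dist3 z x y" "dist3 z y x"
      by (auto simp: dist3_def)
    have m: "med3 x z y = med3 x y z" "med3 y x z = med3 x y z" "med3 y z x = med3 x y z"
       "med3 z x y = med3 x y z" "med3 z y x = med3 x y z"
      by (auto simp: triple_defs min_def max_def)
    show ?thesis using d d'
      by (simp add: edge_val_def child_state_def m)
        (auto simp: weight_def triple_defs min_def max_def)
  next
    case a
    then have "2 * s \<le> u" using assms by auto
    from weight_children_isosceles[OF this, of x z r] a
    show ?thesis using weight_perm(2)[of r "s-1" z]
      by (simp add: edge_val_def child_state_def dist3_def v_def)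
  next
    case b
    then have "2 * s \<le> u" using assms by auto
    from weight_children_isosceles[OF this, of z x r] b
    show ?thesis using weight_perm(2)[of r "s-1" x] weight_perm(2)[of r s x x z] weight_perm(1)[of r s x z x]
      by (simp add: edge_val_def child_state_def dist3_def v_def)
  next
    case b'
    then have "2 * s \<le> u" using assms by auto
    from weight_children_isosceles[OF this, of y z r] b'
    show ?thesis using weight_perm(2)[of r "s-1" z] weight_perm(1)[of r s z y z]
      by (simp add: edge_val_def child_state_def dist3_def v_def)
  qed
qed

text \<open>With no levels left, a nonconstant cell has no downs left either, and the bound in
  \<open>budget\<close> collapses to \<open>H\<close>.\<close>

lemma budget_end:
  assumes "budget 0 s H x y z" "0 \<le> H"
  shows "gap3 x y z \<le> H"
proof (cases "x = y \<and> y = z")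
  case True
  then show ?thesis using assms by simp
next
  case False
  then have "s = 0" using assms by (auto simp: budget_def)
  then show ?thesis using assms by (simp add: budget_def)
qed

text \<open>One of the \<open>l\<close> levels is set aside for a cell with three different values,
  hence \<open>l - 1 - k\<close>. For any other cell the binomial coefficient in
  \<open>budget\<close> is at least as large.\<close>

lemma budget_start:
  assumes "gap3 x y z \<le> H" "0 \<le> H" "2 * k + 1 \<le> l"
  shows "budget l k (H / (2 ^ k * real ((l - 1 - k) choose k))) x y z"
proof -
  let ?M = "2 ^ k * real ((l - 1 - k) choose k)" and ?c = "(l - k - of_bool (dist3 x y z)) choose k"
  have "(l - 1 - k) choose k > 0" using assms(3) by (intro zero_less_binomial) auto
  then have M: "?M > 0" by simp
  have "(l - 1 - k) choose k \<le> ?c" by (rule binomial_right_mono) auto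
  then have "?M \<le> 2 ^ k * real ?c" by simp
  then have "H / ?M * ?M \<le> H / ?M * (2 ^ k * real ?c)"
    using assms M by (intro mult_left_mono) auto
  then have "gap3 x y z \<le> H / ?M * 2 ^ k * real ?c" using assms M by (simp add: mult.assoc)
  then show ?thesis using assms unfolding budget_def by auto
qed

section \<open>Vertex values on the dyadic lattice\<close>

text \<open>
  The cell \<open>(i, j)\<close> has the vertices \<open>(i, j)\<close>, \<open>(i + 1, j)\<close>, \<open>(i, j + 1)\<close> of the lattice of mesh
  \<open>2^(-n)\<close> spanned by two sides of the triangle.
\<close>

primrec cells :: "nat \<Rightarrow> (nat \<times> nat) set" where
  "cells 0 = {(0, 0)}"
| "cells (Suc n) = (\<Union>(i, j) \<in> cells n. {(2 * i, 2 * j), (Suc (2 * i), 2 * j), (2 * i, Suc (2 * j))})"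

lemma finite_cells [simp]: "finite (cells n)"
  by (induction n) auto

lemma card_cells: "card (cells n) \<le> 3 ^ n"
proof (induction n)
  case (Suc n)
  have "card (cells (Suc n)) \<le> (\<Sum>c\<in>cells n. card (case c of (i, j) \<Rightarrow>
      {(2 * i, 2 * j), (Suc (2 * i), 2 * j), (2 * i, Suc (2 * j))}))"
    unfolding cells.simps by (rule card_UN_le) simp
  also have "\<dots> \<le> (\<Sum>c\<in>cells n. 3)"
    by (intro sum_mono) (auto simp: card_insert_if)
  also have "\<dots> \<le> 3 ^ Suc n" using Suc by simp
  finally show ?case .
qed simp

lemma sum_UN_le_nat:
  fixes f :: "'b \<Rightarrow> nat"
  assumes "finite I" "\<And>i. i \<in> I \<Longrightarrow> finite (A i)"
  shows "sum f (\<Union>i\<in>I. A i) \<le> (\<Sum>i\<in>I. sum f (A i))"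
  using assms
proof (induction I rule: finite_induct)
  case (insert i I)
  have "sum f (A i \<union> (\<Union>i\<in>I. A i)) \<le> sum f (A i) + sum f (\<Union>i\<in>I. A i)"
    using insert by (subst sum_Un_nat) auto
  also have "\<dots> \<le> (\<Sum>i\<in>insert i I. sum f (A i))"
    using insert by simp
  finally show ?case by simp
qed simp

lemma sum_cells_Suc_le:
  fixes f :: "nat \<Rightarrow> nat \<Rightarrow> nat"
  shows "(\<Sum>(p, q)\<in>cells (Suc n). f p q) \<le>
    (\<Sum>(i, j)\<in>cells n. f (2 * i) (2 * j) + f (Suc (2 * i)) (2 * j) + f (2 * i) (Suc (2 * j)))"
proof -
  have "(\<Sum>(p, q)\<in>cells (Suc n). f p q) \<le> (\<Sum>c\<in>cells n. \<Sum>(p, q)\<in>(case c of (i, j) \<Rightarrow>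
      {(2 * i, 2 * j), (Suc (2 * i), 2 * j), (2 * i, Suc (2 * j))}). f p q)"
    unfolding cells.simps by (rule sum_UN_le_nat) auto
  also have "\<dots> = (\<Sum>(i, j)\<in>cells n. f (2 * i) (2 * j) + f (Suc (2 * i)) (2 * j) + f (2 * i) (Suc (2 * j)))"
    by (intro sum.cong refl) (auto split: prod.splits)
  finally show ?thesis .
qed

definition cell_vals :: "(nat \<Rightarrow> nat \<Rightarrow> real) \<Rightarrow> (real \<Rightarrow> real \<Rightarrow> real \<Rightarrow> 'b) \<Rightarrow> nat \<Rightarrow> nat \<Rightarrow> 'b" where
  "cell_vals V f i j = f (V i j) (V (Suc i) j) (V i (Suc j))"

text \<open>
  A lattice point that is not a vertex of the previous level is the midpoint of an edge of exactly
  one upward triangle, which is found by halving the coordinates; hence the values are well defined at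
  vertices shared by several cells.
\<close>

definition refine_vals :: "nat \<Rightarrow> (nat \<Rightarrow> nat \<Rightarrow> real) \<Rightarrow> (nat \<Rightarrow> nat \<Rightarrow> nat) \<Rightarrow> nat \<Rightarrow> nat \<Rightarrow> real" where
  "refine_vals u V \<sigma> p q =
     (let i = p div 2; j = q div 2; v = ratio u (\<sigma> i j);
          x = V i j; y = V (Suc i) j; z = V i (Suc j)
      in if even p then (if even q then x else edge_val v x z y)
         else if even q then edge_val v x y z else edge_val v y z x)"

definition refine_state :: "(nat \<Rightarrow> nat \<Rightarrow> real) \<Rightarrow> (nat \<Rightarrow> nat \<Rightarrow> nat) \<Rightarrow> nat \<Rightarrow> nat \<Rightarrow> nat" where
  "refine_state V \<sigma> p q =
     (let i = p div 2; j = q div 2; s = \<sigma> i j;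
          x = V i j; y = V (Suc i) j; z = V i (Suc j)
      in if even p then (if even q then child_state s x y z else child_state s z x y)
         else child_state s y x z)"

lemma refine_cell:
  fixes V \<sigma> i j u
  defines "v \<equiv> ratio u (\<sigma> i j)"
  defines "x \<equiv> V i j" and "y \<equiv> V (Suc i) j" and "z \<equiv> V i (Suc j)"
  shows "cell_vals (refine_vals u V \<sigma>) f (2 * i) (2 * j) = f x (edge_val v x y z) (edge_val v x z y)"
    "cell_vals (refine_vals u V \<sigma>) f (Suc (2 * i)) (2 * j) = f (edge_val v y x z) y (edge_val v y z x)"
    "cell_vals (refine_vals u V \<sigma>) f (2 * i) (Suc (2 * j)) = f (edge_val v z x y) (edge_val v z y x) z"
    "refine_state V \<sigma> (2 * i) (2 * j) = child_state (\<sigma> i j) x y z"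
    "refine_state V \<sigma> (Suc (2 * i)) (2 * j) = child_state (\<sigma> i j) y x z"
    "refine_state V \<sigma> (2 * i) (Suc (2 * j)) = child_state (\<sigma> i j) z x y"
  using edge_val_commute
  by (auto simp: cell_vals_def refine_vals_def refine_state_def Let_def v_def x_def y_def z_def)

section \<open>Blocks of levels and their bounds\<close>

text \<open>Blocks consist of \<open>l\<close> levels and begin with \<open>k\<close> downs in stock.\<close>

primrec conf :: "nat \<Rightarrow> nat \<Rightarrow> (nat \<Rightarrow> nat \<Rightarrow> real) \<Rightarrow> nat \<Rightarrow>
    (nat \<Rightarrow> nat \<Rightarrow> real) \<times> (nat \<Rightarrow> nat \<Rightarrow> nat)" where
  "conf l k V 0 = (V, \<lambda>_ _. k)"
| "conf l k V (Suc n) =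
     (refine_vals (l - n mod l) (fst (conf l k V n)) (snd (conf l k V n)),
      if l dvd Suc n then (\<lambda>_ _. k) else refine_state (fst (conf l k V n)) (snd (conf l k V n)))"

lemma cells_SucE:
  assumes "(p, q) \<in> cells (Suc n)"
  obtains i j where "(i, j) \<in> cells n"
    "(p, q) = (2 * i, 2 * j) \<or> (p, q) = (Suc (2 * i), 2 * j) \<or> (p, q) = (2 * i, Suc (2 * j))"
  using assms by auto

text \<open>\<open>M\<close> is the factor gained by one block, so
  \<open>H / M ^ Suc (n div l)\<close> is the gap aimed at for the end of the current block. Inside
  a block \<open>budget_child\<close> applies; at its end \<open>budget_end\<close> yields a gap
  bound, from which \<open>budget_start\<close> opens the next block.\<close>

lemma conf_budget:
  assumes V: "\<And>i j. (i, j) \<in> cells m \<Longrightarrow> cell_vals V gap3 i j \<le> H"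
    and H: "0 \<le> H" and l: "2 * k + 1 \<le> l"
  defines "M \<equiv> 2 ^ k * real ((l - 1 - k) choose k)"
  shows "(i, j) \<in> cells (m + n) \<Longrightarrow>
    cell_vals (fst (conf l k V n)) (budget (l - n mod l) (snd (conf l k V n) i j) (H / M ^ Suc (n div l))) i j"
proof (induction n arbitrary: i j)
  case 0
  have "budget l k (H / M) (V i j) (V (Suc i) j) (V i (Suc j))"
    unfolding M_def using V[of i j] 0 H l by (intro budget_start) (auto simp: cell_vals_def)
  then show ?case by (simp add: cell_vals_def)
next
  case (Suc n p q)
  define W where "W = fst (conf l k V n)"
  define \<sigma> where "\<sigma> = snd (conf l k V n)"
  define H' where "H' = H / M ^ Suc (n div l)"
  have M: "M \<ge> 0" by (simp add: M_def)
  have H': "H' \<ge> 0" using H M by (simp add: H'_def)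
  obtain u where u: "l - n mod l = Suc u" using l
    by (metis Suc_diff_Suc le_add2 less_le_trans mod_less_divisor zero_less_one)
  obtain i j where ij: "(i, j) \<in> cells (m + n)"
    "(p, q) = (2 * i, 2 * j) \<or> (p, q) = (Suc (2 * i), 2 * j) \<or> (p, q) = (2 * i, Suc (2 * j))"
    using Suc.prems by (auto elim: cells_SucE)
  let ?x = "W i j" and ?y = "W (Suc i) j" and ?z = "W i (Suc j)"
  have B: "budget (Suc u) (\<sigma> i j) H' ?x ?y ?z"
    using Suc.IH[OF ij(1)] by (simp add: cell_vals_def u W_def \<sigma>_def H'_def)
  have B2: "budget (Suc u) (\<sigma> i j) H' ?y ?x ?z" using B budget_perm by metis
  have B3: "budget (Suc u) (\<sigma> i j) H' ?z ?x ?y" using B budget_perm by metis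
  have child: "cell_vals (refine_vals (Suc u) W \<sigma>) (budget u (refine_state W \<sigma> p q) H') p q"
    using ij(2)
  proof (elim disjE Pair_inject, goal_cases)
    case 1
    then show ?case using budget_child[OF B H'] by (simp only: refine_cell)
  next
    case 2
    then show ?case using budget_child[OF B2 H'] budget_perm by (metis refine_cell(2,5))
  next
    case 3
    then show ?case using budget_child[OF B3 H'] budget_perm by (metis refine_cell(3,6))
  qed
  show ?case
  proof (cases "l dvd Suc n")
    case False
    then have md: "Suc n mod l = Suc (n mod l)" "Suc n div l = n div l"
      by (auto simp: mod_Suc div_Suc dvd_eq_mod_eq_0)
    have "l - Suc n mod l = u" using u md by simp
    then show ?thesis using child False md
      by (simp add: W_def[symmetric] \<sigma>_def[symmetric] u H'_def)
  next
    case True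
    then have md: "Suc n mod l = 0" "Suc (n mod l) = l" "Suc n div l = Suc (n div l)"
      by (auto simp: mod_Suc div_Suc dvd_eq_mod_eq_0 split: if_splits)
    then have "u = 0" using u by simp
    then have "cell_vals (refine_vals (Suc u) W \<sigma>) gap3 p q \<le> H'"
      using child H' budget_end unfolding cell_vals_def by metis
    then have "cell_vals (refine_vals (Suc u) W \<sigma>) (budget l k (H' / M)) p q"
      unfolding cell_vals_def M_def using H' l by (intro budget_start) auto
    moreover have "H' / M = H / M ^ Suc (Suc (n div l))"
      by (simp add: H'_def field_simps)
    ultimately show ?thesis using True md
      by (simp add: W_def[symmetric] \<sigma>_def[symmetric] u)
  qed
qed

text \<open>Inside a block the gap exceeds the bound aimed at for its end by at most a power of two
  times a binomial coefficient, hence by at most \<open>4 ^ l\<close>. This loss does not accumulate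
  over the blocks, and each block gains at least \<open>2 powr (\<alpha> * l)\<close>.\<close>

lemma conf_gap:
  assumes V: "\<And>i j. (i, j) \<in> cells m \<Longrightarrow> cell_vals V gap3 i j \<le> H"
    and H: "0 \<le> H" and l: "2 * k + 1 \<le> l"
    and ij: "(i, j) \<in> cells (m + n)"
    and M: "2 powr (\<alpha> * l) \<le> 2 ^ k * real ((l - 1 - k) choose k)" and \<alpha>: "0 < \<alpha>"
  shows "cell_vals (fst (conf l k V n)) gap3 i j \<le> H * 4 ^ l * 2 powr (- \<alpha> * n)"
proof -
  define M where "M = 2 ^ k * real ((l - 1 - k) choose k)"
  define s where "s = snd (conf l k V n) i j"
  define u where "u = l - n mod l"
  define x where "x = fst (conf l k V n) i j"
  define y where "y = fst (conf l k V n) (Suc i) j"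
  define z where "z = fst (conf l k V n) i (Suc j)"
  have B: "budget u s (H / M ^ Suc (n div l)) x y z"
    using conf_budget[OF V H l ij] by (simp add: cell_vals_def s_def u_def M_def x_def y_def z_def)
  have M0: "M > 0" using M powr_gt_zero[of 2 "\<alpha> * l"] unfolding M_def by linarith
  have "2 powr (\<alpha> * n) \<le> 2 powr (\<alpha> * l * real (Suc (n div l)))"
  proof (intro powr_mono)
    have "n \<le> l * Suc (n div l)" using l dividend_less_div_times[of l n] by (simp add: mult.commute)
    then have "real n \<le> real l * real (Suc (n div l))" by (metis of_nat_le_iff of_nat_mult)
    then show "\<alpha> * real n \<le> \<alpha> * real l * real (Suc (n div l))" using \<alpha> by (simp add: mult.assoc)
  qed simp
  also have "\<dots> = (2 powr (\<alpha> * l)) ^ Suc (n div l)"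
    by (simp add: powr_powr distrib_left powr_add flip: powr_realpow)
  also have "\<dots> \<le> M ^ Suc (n div l)"
    by (intro power_mono) (use M in \<open>auto simp: M_def\<close>)
  finally have H1: "H / M ^ Suc (n div l) \<le> H * 2 powr (- \<alpha> * n)"
    using H M0 by (simp add: powr_minus divide_simps) (simp add: mult_left_mono)
  show ?thesis
  proof (cases "x = y \<and> y = z")
    case True
    then show ?thesis using H by (simp add: cell_vals_def x_def y_def z_def)
  next
    case False
    then have s: "2 * s \<le> u" and g: "gap3 x y z \<le>
        (H / M ^ Suc (n div l)) * 2 ^ s * real ((u - s - of_bool (dist3 x y z)) choose s)"
      using B by (auto simp: budget_def)
    have "(u - s - of_bool (dist3 x y z)) choose s \<le> 2 ^ (u - s - of_bool (dist3 x y z))"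
      by (rule binomial_le_pow2)
    also have "\<dots> \<le> 2 ^ l" by (intro power_increasing) (auto simp: u_def)
    finally have "2 ^ s * ((u - s - of_bool (dist3 x y z)) choose s) \<le> 2 ^ l * 2 ^ l"
      using s by (intro mult_mono power_increasing) (auto simp: u_def)
    also have "\<dots> = 4 ^ l" by (simp flip: power_mult_distrib)
    finally have "real (2 ^ s * ((u - s - of_bool (dist3 x y z)) choose s)) \<le> real (4 ^ l)"
      by (rule of_nat_mono)
    then have "(H / M ^ Suc (n div l)) * (2 ^ s * real ((u - s - of_bool (dist3 x y z)) choose s))
       \<le> (H * 2 powr (- \<alpha> * n)) * 4 ^ l"
      using H1 H M0 by (intro mult_mono) auto
    then show ?thesis using g by (simp add: cell_vals_def x_def y_def z_def mult_ac)
  qed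
qed

definition cell_weight :: "real \<Rightarrow> (nat \<Rightarrow> nat \<Rightarrow> real) \<Rightarrow> (nat \<Rightarrow> nat \<Rightarrow> nat) \<Rightarrow> nat \<Rightarrow> nat \<Rightarrow> nat" where
  "cell_weight r V \<sigma> i j = cell_vals V (weight r (\<sigma> i j)) i j"

text \<open>The total weight starts with at most \<open>3 ^ m * 2 ^ k\<close> and does not grow
  inside a block by \<open>weight_children\<close>. When the state is reset, a cell that weighed at
  least \<open>1\<close> weighs \<open>2 ^ k\<close>, so each new block costs a factor
  \<open>2 ^ k\<close>.\<close>

lemma conf_weight:
  assumes V: "\<And>i j. (i, j) \<in> cells m \<Longrightarrow> cell_vals V gap3 i j \<le> H"
    and H: "0 \<le> H" and l: "2 * k + 1 \<le> l"
  shows "(\<Sum>(i, j)\<in>cells (m + n). cell_weight r (fst (conf l k V n)) (snd (conf l k V n)) i j)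
    \<le> 3 ^ m * 2 ^ (k * Suc (n div l))"
proof (induction n)
  case 0
  have "(\<Sum>(i, j)\<in>cells m. cell_weight r V (\<lambda>_ _. k) i j) \<le> (\<Sum>(i, j)\<in>cells m. 2 ^ k)"
    by (intro sum_mono) (auto simp: cell_weight_def cell_vals_def weight_def)
  also have "\<dots> \<le> 3 ^ m * 2 ^ k" using card_cells[of m] by simp
  finally show ?case by simp
next
  case (Suc n)
  define W where "W = fst (conf l k V n)"
  define \<sigma> where "\<sigma> = snd (conf l k V n)"
  define W' where "W' = refine_vals (l - n mod l) W \<sigma>"
  have "(\<Sum>(i, j)\<in>cells (Suc (m + n)). cell_weight r W' (refine_state W \<sigma>) i j) \<le>
    (\<Sum>(i, j)\<in>cells (m + n). cell_weight r W' (refine_state W \<sigma>) (2 * i) (2 * j)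
      + cell_weight r W' (refine_state W \<sigma>) (Suc (2 * i)) (2 * j)
      + cell_weight r W' (refine_state W \<sigma>) (2 * i) (Suc (2 * j)))"
    by (rule sum_cells_Suc_le)
  also have "\<dots> \<le> (\<Sum>(i, j)\<in>cells (m + n). cell_weight r W \<sigma> i j)"
  proof (rule sum_mono, clarify)
    fix i j assume ij: "(i, j) \<in> cells (m + n)"
    let ?x = "W i j" and ?y = "W (Suc i) j" and ?z = "W i (Suc j)"
    have *: "?x = ?y \<and> ?y = ?z \<or> 2 * \<sigma> i j \<le> l - n mod l"
      using conf_budget[OF V H l ij] by (auto simp: cell_vals_def budget_def W_def \<sigma>_def)
    show "cell_weight r W' (refine_state W \<sigma>) (2 * i) (2 * j)
      + cell_weight r W' (refine_state W \<sigma>) (Suc (2 * i)) (2 * j)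
      + cell_weight r W' (refine_state W \<sigma>) (2 * i) (Suc (2 * j)) \<le> cell_weight r W \<sigma> i j"
      using weight_children[OF *, of r] weight_perm
      unfolding cell_weight_def W'_def refine_cell by (simp add: cell_vals_def)
  qed
  also have "\<dots> \<le> 3 ^ m * 2 ^ (k * Suc (n div l))" using Suc by (simp add: W_def \<sigma>_def)
  finally have *: "(\<Sum>(i, j)\<in>cells (Suc (m + n)). cell_weight r W' (refine_state W \<sigma>) i j)
    \<le> 3 ^ m * 2 ^ (k * Suc (n div l))" .
  show ?case
  proof (cases "l dvd Suc n")
    case False
    then have "Suc n div l = n div l" by (auto simp: div_Suc dvd_eq_mod_eq_0)
    then show ?thesis using * False by (simp add: W'_def W_def \<sigma>_def)
  next
    case True
    then have dv: "Suc n div l = Suc (n div l)" by (auto simp: div_Suc dvd_eq_mod_eq_0)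
    have "(\<Sum>(i, j)\<in>cells (Suc (m + n)). cell_weight r W' (\<lambda>_ _. k) i j)
      \<le> (\<Sum>(i, j)\<in>cells (Suc (m + n)). 2 ^ k * cell_weight r W' (refine_state W \<sigma>) i j)"
      by (intro sum_mono) (auto simp: cell_weight_def cell_vals_def weight_def)
    also have "\<dots> = 2 ^ k * (\<Sum>(i, j)\<in>cells (Suc (m + n)). cell_weight r W' (refine_state W \<sigma>) i j)"
      by (simp add: sum_distrib_left case_prod_unfold)
    also have "\<dots> \<le> 2 ^ k * (3 ^ m * 2 ^ (k * Suc (n div l)))"
      using * by (intro mult_left_mono) auto
    also have "\<dots> = 3 ^ m * 2 ^ (k * Suc (Suc n div l))" by (simp add: dv power_add)
    finally show ?thesis using True by (simp add: W'_def W_def \<sigma>_def)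
  qed
qed

lemma lo3_ge: "l \<le> x \<Longrightarrow> l \<le> y \<Longrightarrow> l \<le> z \<Longrightarrow> l \<le> lo3 x y z"
  by (simp add: lo3_def)

lemma hi3_le: "x \<le> u \<Longrightarrow> y \<le> u \<Longrightarrow> z \<le> u \<Longrightarrow> hi3 x y z \<le> u"
  by (simp add: hi3_def)

text \<open>This nesting of the ranges is what allows a limit value to be chosen at each point of
  the triangle.\<close>

lemma conf_vals_between:
  assumes V: "\<And>i j. (i, j) \<in> cells m \<Longrightarrow> cell_vals V gap3 i j \<le> H"
    and H: "0 \<le> H" and l: "2 * k + 1 \<le> l"
    and ij: "(i, j) \<in> cells (m + n)"
    and pq: "(p, q) = (2 * i, 2 * j) \<or> (p, q) = (Suc (2 * i), 2 * j) \<or> (p, q) = (2 * i, Suc (2 * j))"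
  shows "cell_vals (fst (conf l k V n)) lo3 i j \<le> cell_vals (fst (conf l k V (Suc n))) lo3 p q"
    "cell_vals (fst (conf l k V (Suc n))) hi3 p q \<le> cell_vals (fst (conf l k V n)) hi3 i j"
proof -
  define W where "W = fst (conf l k V n)"
  define \<sigma> where "\<sigma> = snd (conf l k V n)"
  define u where "u = l - n mod l"
  define v where "v = ratio u (\<sigma> i j)"
  let ?x = "W i j" and ?y = "W (Suc i) j" and ?z = "W i (Suc j)"
  have *: "?x = ?y \<and> ?y = ?z \<or> 0 \<le> v \<and> v \<le> 1"
    using conf_budget[OF V H l ij] budget_ratio by (auto simp: cell_vals_def W_def \<sigma>_def v_def u_def)
  define L where "L = lo3 ?x ?y ?z"
  define U where "U = hi3 ?x ?y ?z"
  have L: "lo3 ?y ?x ?z = L" "lo3 ?x ?z ?y = L" "lo3 ?z ?x ?y = L" "lo3 ?y ?z ?x = L" "lo3 ?z ?y ?x = L"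
    unfolding L_def using lo3_perm by metis+
  have U: "hi3 ?y ?x ?z = U" "hi3 ?x ?z ?y = U" "hi3 ?z ?x ?y = U" "hi3 ?y ?z ?x = U" "hi3 ?z ?y ?x = U"
    unfolding U_def using hi3_perm by metis+
  have x: "L \<le> ?x" "L \<le> ?y" "L \<le> ?z" "?x \<le> U" "?y \<le> U" "?z \<le> U"
    unfolding L_def U_def lo3_def hi3_def by simp_all
  have c: "?y = ?x \<and> ?x = ?z \<or> 0 \<le> v \<and> v \<le> 1" "?x = ?z \<and> ?z = ?y \<or> 0 \<le> v \<and> v \<le> 1"
    "?z = ?x \<and> ?x = ?y \<or> 0 \<le> v \<and> v \<le> 1" "?y = ?z \<and> ?z = ?x \<or> 0 \<le> v \<and> v \<le> 1"
    "?z = ?y \<and> ?y = ?x \<or> 0 \<le> v \<and> v \<le> 1"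
    using * by auto
  note e = edge_val_between[OF *, folded L_def U_def]
    edge_val_between[OF c(1), unfolded L U] edge_val_between[OF c(2), unfolded L U]
    edge_val_between[OF c(3), unfolded L U] edge_val_between[OF c(4), unfolded L U]
    edge_val_between[OF c(5), unfolded L U]
  have r: "cell_vals W lo3 i j \<le> cell_vals (refine_vals u W \<sigma>) lo3 p q \<and>
     cell_vals (refine_vals u W \<sigma>) hi3 p q \<le> cell_vals W hi3 i j"
    unfolding cell_vals_def[of W] L_def[symmetric] U_def[symmetric] using pq
  proof (elim disjE Pair_inject, goal_cases)
    case 1
    show ?case unfolding 1 refine_cell v_def[symmetric] by (intro conjI lo3_ge hi3_le x e)
  next
    case 2
    show ?case unfolding 2 refine_cell v_def[symmetric] by (intro conjI lo3_ge hi3_le x e)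
  next
    case 3
    show ?case unfolding 3 refine_cell v_def[symmetric] by (intro conjI lo3_ge hi3_le x e)
  qed
  then show "cell_vals (fst (conf l k V n)) lo3 i j \<le> cell_vals (fst (conf l k V (Suc n))) lo3 p q"
    "cell_vals (fst (conf l k V (Suc n))) hi3 p q \<le> cell_vals (fst (conf l k V n)) hi3 i j"
    by (simp_all add: W_def \<sigma>_def u_def)
qed

section \<open>Geometry of the cells\<close>

definition vert :: "'a::real_vector \<Rightarrow> 'a \<Rightarrow> 'a \<Rightarrow> nat \<Rightarrow> nat \<Rightarrow> nat \<Rightarrow> 'a" where
  "vert a b c n i j = a + (real i / 2 ^ n) *\<^sub>R (b - a) + (real j / 2 ^ n) *\<^sub>R (c - a)"

definition tri :: "'a::real_vector \<Rightarrow> 'a \<Rightarrow> 'a \<Rightarrow> nat \<Rightarrow> nat \<Rightarrow> nat \<Rightarrow> 'a set" where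
  "tri a b c n i j = convex hull {vert a b c n i j, vert a b c n (Suc i) j, vert a b c n i (Suc j)}"

lemma vert_Suc_double: "vert a b c (Suc n) (2 * i) (2 * j) = vert a b c n i j"
  by (simp add: vert_def)

lemma midpoint_affine:
  fixes a e f :: "'a::real_vector"
  shows "midpoint (a + s *\<^sub>R e + t *\<^sub>R f) (a + s' *\<^sub>R e + t' *\<^sub>R f) =
    a + ((s + s') / 2) *\<^sub>R e + ((t + t') / 2) *\<^sub>R f"
proof -
  have h: "2 *\<^sub>R ((u / 2) *\<^sub>R x) = u *\<^sub>R x" for u and x :: 'a
    by simp
  have "(a + s *\<^sub>R e + t *\<^sub>R f) + (a + s' *\<^sub>R e + t' *\<^sub>R f)
      = 2 *\<^sub>R (a + ((s + s') / 2) *\<^sub>R e + ((t + t') / 2) *\<^sub>R f)"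
    unfolding scaleR_add_right h by (simp add: scaleR_add_left scaleR_2)
  then show ?thesis by (simp add: midpoint_def)
qed

lemma vert_midpoints:
  "midpoint (vert a b c n i j) (vert a b c n (Suc i) j) = vert a b c (Suc n) (Suc (2 * i)) (2 * j)"
  "midpoint (vert a b c n i j) (vert a b c n i (Suc j)) = vert a b c (Suc n) (2 * i) (Suc (2 * j))"
  "midpoint (vert a b c n (Suc i) j) (vert a b c n i (Suc j)) = vert a b c (Suc n) (Suc (2 * i)) (Suc (2 * j))"
  unfolding vert_def midpoint_affine by (simp_all add: field_simps)

text \<open>Halving the mesh doubles the coordinates, so the corner triangles of a cell are its
  three children in \<open>cells\<close>. From here on the construction is handled in lattice
  coordinates.\<close>

lemma sierpinski_triples_eq:
  "sierpinski_triples (a, b, c) n =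
    (\<lambda>(i, j). (vert a b c n i j, vert a b c n (Suc i) j, vert a b c n i (Suc j))) ` cells n"
proof (induction n)
  case 0
  then show ?case by (simp add: vert_def)
next
  case (Suc n)
  have *: "vert a b c n i j = vert a b c (Suc n) (2 * i) (2 * j)"
    "vert a b c n (Suc i) j = vert a b c (Suc n) (Suc (Suc (2 * i))) (2 * j)"
    "vert a b c n i (Suc j) = vert a b c (Suc n) (2 * i) (Suc (Suc (2 * j)))" for i j
    using vert_Suc_double[of a b c n i j] vert_Suc_double[of a b c n "Suc i" j]
      vert_Suc_double[of a b c n i "Suc j"] by simp_all
  have "corner_triangles (vert a b c n i j, vert a b c n (Suc i) j, vert a b c n i (Suc j)) =
    (\<lambda>(i, j). (vert a b c (Suc n) i j, vert a b c (Suc n) (Suc i) j, vert a b c (Suc n) i (Suc j))) `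
     {(2 * i, 2 * j), (Suc (2 * i), 2 * j), (2 * i, Suc (2 * j))}" for i j
    unfolding corner_triangles.simps vert_midpoints by (simp add: *)
  then show ?case
    unfolding sierpinski_triples.simps Suc cells.simps image_UN UN_simps
    by (intro SUP_cong refl) (auto split: prod.splits)
qed

lemma sierpinski_level_eq: "sierpinski_level a b c n = (\<Union>(i, j)\<in>cells n. tri a b c n i j)"
  unfolding sierpinski_level_def sierpinski_triples_eq tri_def
  by (auto simp: case_prod_unfold)

lemma tri_coords:
  assumes "x \<in> tri a b c n i j"
  obtains s t where "0 \<le> s" "0 \<le> t" "s + t \<le> 1"
    "x = a + ((real i + s) / 2 ^ n) *\<^sub>R (b - a) + ((real j + t) / 2 ^ n) *\<^sub>R (c - a)"
proof -
  obtain r s t where rst: "0 \<le> r" "0 \<le> s" "0 \<le> t" "r + s + t = 1"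
    and x: "x = r *\<^sub>R vert a b c n i j + s *\<^sub>R vert a b c n (Suc i) j + t *\<^sub>R vert a b c n i (Suc j)"
    using assms unfolding tri_def convex_hull_3 by auto
  have v: "vert a b c n (Suc i) j = vert a b c n i j + (1 / 2 ^ n) *\<^sub>R (b - a)"
    "vert a b c n i (Suc j) = vert a b c n i j + (1 / 2 ^ n) *\<^sub>R (c - a)"
    by (simp_all add: vert_def add_divide_distrib scaleR_add_left)
  have "x = (r + s + t) *\<^sub>R vert a b c n i j + (s / 2 ^ n) *\<^sub>R (b - a) + (t / 2 ^ n) *\<^sub>R (c - a)"
    unfolding x v by (simp add: scaleR_add_left scaleR_add_right)
  also have "\<dots> = a + ((real i + s) / 2 ^ n) *\<^sub>R (b - a) + ((real j + t) / 2 ^ n) *\<^sub>R (c - a)"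
    unfolding rst by (simp add: vert_def add_divide_distrib scaleR_add_left)
  finally show thesis using that[of s t] rst by auto
qed

lemma tri_child_subset:
  assumes "(p, q) = (2 * i, 2 * j) \<or> (p, q) = (Suc (2 * i), 2 * j) \<or> (p, q) = (2 * i, Suc (2 * j))"
  shows "tri a b c (Suc n) p q \<subseteq> tri a b c n i j"
proof -
  let ?T = "tri a b c n i j"
  have v: "vert a b c n i j \<in> ?T" "vert a b c n (Suc i) j \<in> ?T" "vert a b c n i (Suc j) \<in> ?T"
    unfolding tri_def by (auto intro: hull_inc)
  have cv: "convex ?T" unfolding tri_def by (rule convex_convex_hull)
  have mid: "midpoint x y \<in> ?T" if "x \<in> ?T" "y \<in> ?T" for x y
    using cv that by (metis closed_segment_subset midpoint_in_closed_segment subsetD)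
  have w: "vert a b c (Suc n) (2 * i) (2 * j) \<in> ?T"
    "vert a b c (Suc n) (Suc (Suc (2 * i))) (2 * j) \<in> ?T"
    "vert a b c (Suc n) (2 * i) (Suc (Suc (2 * j))) \<in> ?T"
    using v vert_Suc_double[of a b c n i j] vert_Suc_double[of a b c n "Suc i" j]
      vert_Suc_double[of a b c n i "Suc j"] by simp_all
  have "{vert a b c (Suc n) p q, vert a b c (Suc n) (Suc p) q, vert a b c (Suc n) p (Suc q)} \<subseteq> ?T"
    using assms w mid[OF v(1,2)] mid[OF v(1,3)] mid[OF v(2,3)] unfolding vert_midpoints by auto
  then show ?thesis unfolding tri_def[of _ _ _ "Suc n"] using cv by (rule hull_minimal)
qed

lemma compact_tri: "compact (tri a b c n i j :: 'a::euclidean_space set)"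
  unfolding tri_def by (intro compact_convex_hull finite_imp_compact) simp

lemma compact_sierpinski: "compact (sierpinski_triangle a b c :: 'a::euclidean_space set)"
proof -
  have "compact (sierpinski_level a b c n)" for n
    unfolding sierpinski_level_eq by (intro compact_UN) (auto intro: compact_tri)
  then show ?thesis unfolding sierpinski_triangle_def
    by (metis (mono_tags, lifting) UNIV_I compact_Inter empty_iff image_iff)
qed

lemma sierpinski_cell:
  assumes "x \<in> sierpinski_triangle a b c"
  obtains i j where "(i, j) \<in> cells n" "x \<in> tri a b c n i j"
  using assms unfolding sierpinski_triangle_def sierpinski_level_eq by fastforce

section \<open>Metric estimates in the equilateral lattice\<close>

locale equilateral =
  fixes a b c :: "'a::euclidean_space"
  assumes sides: "dist a b = 1" "dist b c = 1" "dist a c = 1"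
begin

lemma inner_sides: "(b - a) \<bullet> (b - a) = 1" "(c - a) \<bullet> (c - a) = 1" "(b - a) \<bullet> (c - a) = 1 / 2"
proof -
  show 1: "(b - a) \<bullet> (b - a) = 1" and 2: "(c - a) \<bullet> (c - a) = 1"
    using sides by (simp_all add: dist_norm norm_minus_commute flip: power2_norm_eq_inner)
  have "((b - a) - (c - a)) \<bullet> ((b - a) - (c - a)) = 1"
    using sides by (simp add: dist_norm flip: power2_norm_eq_inner)
  then show "(b - a) \<bullet> (c - a) = 1 / 2"
    using 1 2 by (simp only: inner_diff_left inner_diff_right inner_commute)
qed

text \<open>The quadratic form of the triangular lattice; the mixed term comes from the inner
  product \<open>1 / 2\<close> of two sides.\<close>

lemma norm_lattice: "norm (s *\<^sub>R (b - a) + t *\<^sub>R (c - a)) ^ 2 = s\<^sup>2 + t\<^sup>2 + s * t"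
proof -
  have "norm (s *\<^sub>R (b - a) + t *\<^sub>R (c - a)) ^ 2 =
    s * s * ((b - a) \<bullet> (b - a)) + t * t * ((c - a) \<bullet> (c - a)) + 2 * s * t * ((b - a) \<bullet> (c - a))"
    unfolding power2_norm_eq_inner inner_add_left inner_add_right inner_scaleR_left inner_scaleR_right
    by (simp add: inner_commute[of "c - a" "b - a"] algebra_simps del: inner_diff_left inner_diff_right)
  then show ?thesis by (simp add: inner_sides power2_eq_square)
qed

lemma dist_vert: "dist (vert a b c n i j) (vert a b c n (Suc i) j) = 1 / 2 ^ n"
  "dist (vert a b c n i j) (vert a b c n i (Suc j)) = 1 / 2 ^ n"
  "dist (vert a b c n (Suc i) j) (vert a b c n i (Suc j)) = 1 / 2 ^ n"
proof -
  have d: "dist (vert a b c n i j) (vert a b c n (Suc i) j) = norm ((1 / 2 ^ n) *\<^sub>R (a - b))"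
    "dist (vert a b c n i j) (vert a b c n i (Suc j)) = norm ((1 / 2 ^ n) *\<^sub>R (a - c))"
    "dist (vert a b c n (Suc i) j) (vert a b c n i (Suc j)) = norm ((1 / 2 ^ n) *\<^sub>R (b - c))"
    unfolding dist_norm
    by (auto simp: vert_def add_divide_distrib scaleR_add_left scaleR_diff_right intro!: arg_cong[of _ _ norm])
  show "dist (vert a b c n i j) (vert a b c n (Suc i) j) = 1 / 2 ^ n"
    "dist (vert a b c n i j) (vert a b c n i (Suc j)) = 1 / 2 ^ n"
    "dist (vert a b c n (Suc i) j) (vert a b c n i (Suc j)) = 1 / 2 ^ n"
    unfolding d norm_scaleR using sides by (simp_all add: dist_norm)
qed

text \<open>The largest distance in the convex hull of a finite set is attained between two points
  of the set, and all sides have length \<open>1 / 2 ^ n\<close>.\<close>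

lemma diameter_tri: "bounded (tri a b c n i j)" "diameter (tri a b c n i j) \<le> 1 / 2 ^ n"
proof -
  show "bounded (tri a b c n i j)" using compact_tri by (rule compact_imp_bounded)
  have "dist x y \<le> 1 / 2 ^ n" if "x \<in> tri a b c n i j" "y \<in> tri a b c n i j" for x y
  proof -
    define S where "S = {vert a b c n i j, vert a b c n (Suc i) j, vert a b c n i (Suc j)}"
    have S: "dist u v \<le> 1 / 2 ^ n" if "u \<in> S" "v \<in> S" for u v
      using that dist_vert[of n i j] unfolding S_def
      by (elim insertE emptyE) (simp_all add: dist_commute)
    have "finite S" "x \<in> convex hull S" "y \<in> convex hull S"
      using that by (simp_all add: S_def tri_def)
    then obtain u v where uv: "u \<in> S" "v \<in> S" "norm (x - y) \<le> norm (u - v)"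
      using simplex_extremal_le_exists[of S x y] by blast
    from uv(3) S[OF uv(1,2)] have "norm (x - y) \<le> 1 / 2 ^ n"
      unfolding dist_norm by (rule order_trans)
    then show ?thesis by (simp add: dist_norm)
  qed
  then show "diameter (tri a b c n i j) \<le> 1 / 2 ^ n"
    by (intro diameter_le) (auto simp: dist_norm)
qed

lemma dist_in_tri: "x \<in> tri a b c n i j \<Longrightarrow> y \<in> tri a b c n i j \<Longrightarrow> dist x y \<le> 1 / 2 ^ n"
  using diameter_bounded_bound[OF diameter_tri(1)] diameter_tri(2) order_trans by blast

definition corners :: "nat \<Rightarrow> nat \<Rightarrow> (nat \<times> nat) set" where
  "corners i j = {(i, j), (Suc i, j), (i, Suc j)}"

text \<open>
  In the three barycentric lattice coordinates the positions of two nearby cells differ by at most \<open>1\<close> each and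
  the differences have sum \<open>0\<close>.
\<close>

lemma common_corner:
  assumes "x \<in> tri a b c n i j" "y \<in> tri a b c n i' j'" "dist x y \<le> 1 / 2 ^ Suc n"
  obtains p q where "(p, q) \<in> corners i j" "(p, q) \<in> corners i' j'"
proof -
  obtain s t where st: "0 \<le> s" "0 \<le> t" "s + t \<le> 1"
    "x = a + ((real i + s) / 2 ^ n) *\<^sub>R (b - a) + ((real j + t) / 2 ^ n) *\<^sub>R (c - a)"
    using assms(1) by (rule tri_coords)
  obtain s' t' where st': "0 \<le> s'" "0 \<le> t'" "s' + t' \<le> 1"
    "y = a + ((real i' + s') / 2 ^ n) *\<^sub>R (b - a) + ((real j' + t') / 2 ^ n) *\<^sub>R (c - a)"
    using assms(2) by (rule tri_coords)
  define S where "S = real i + s - (real i' + s')"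
  define T where "T = real j + t - (real j' + t')"
  have "x - y = (S / 2 ^ n) *\<^sub>R (b - a) + (T / 2 ^ n) *\<^sub>R (c - a)"
    unfolding st(4) st'(4) S_def T_def by (simp add: diff_divide_distrib scaleR_diff_left)
  also have "\<dots> = (1 / 2 ^ n) *\<^sub>R (S *\<^sub>R (b - a) + T *\<^sub>R (c - a))"
    by (simp add: scaleR_add_right)
  finally have "dist x y = 1 / 2 ^ n * norm (S *\<^sub>R (b - a) + T *\<^sub>R (c - a))"
    by (simp add: dist_norm)
  then have "norm (S *\<^sub>R (b - a) + T *\<^sub>R (c - a)) \<le> 1 / 2"
    using assms(3) by (simp add: field_simps)
  then have "norm (S *\<^sub>R (b - a) + T *\<^sub>R (c - a)) ^ 2 \<le> (1 / 2)\<^sup>2"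
    by (intro power_mono) auto
  \<comment> \<open>Completing squares in this form bounds three coordinates alike: it equals
    \<open>3/4 * S^2 + (S/2 + T)^2\<close>, symmetrically in \<open>T\<close>, and
    \<open>3/4 * (S + T)^2 + 1/4 * (S - T)^2\<close>. So all three squares are at most
    \<open>1/3\<close>.\<close>
  then have Q: "S\<^sup>2 + T\<^sup>2 + S * T \<le> 1 / 4" unfolding norm_lattice by (simp add: power2_eq_square)
  have "S\<^sup>2 < 1" using Q zero_le_power2[of "S / 2 + T"] by (simp add: power2_eq_square algebra_simps)
  moreover have "T\<^sup>2 < 1" using Q zero_le_power2[of "T / 2 + S"] by (simp add: power2_eq_square algebra_simps)
  moreover have "(S + T)\<^sup>2 < 1" using Q zero_le_power2[of "S - T"] by (simp add: power2_eq_square algebra_simps)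
  ultimately have *: "\<bar>S\<bar> < 1" "\<bar>T\<bar> < 1" "\<bar>S + T\<bar> < 1"
    by (simp_all add: abs_square_less_1)
  have "real i < real i' + 2" "real i' < real i + 2" "real j < real j' + 2" "real j' < real j + 2"
    "real i + real j < real i' + real j' + 2" "real i' + real j' < real i + real j + 2"
    using * st(1-3) st'(1-3) unfolding S_def T_def by linarith+
  then have "i < i' + 2" "i' < i + 2" "j < j' + 2" "j' < j + 2" "i + j < i' + j' + 2" "i' + j' < i + j + 2"
    by linarith+
  then have "(i', j') \<in> {(i, j), (Suc i, j), (i, Suc j)} \<or> (i, j) \<in> {(Suc i', j'), (i', Suc j')} \<or>
     (i = Suc i' \<and> j' = Suc j) \<or> (i' = Suc i \<and> j = Suc j')" by auto
  then show thesis
    using that[of i j] that[of i' j'] that[of i "Suc j"] that[of "Suc i" j] by (auto simp: corners_def)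
qed

end

section \<open>Functions with the prescribed vertex values\<close>

lemma cell_vals_range:
  "cell_vals V lo3 i j \<le> V i j" "cell_vals V lo3 i j \<le> V (Suc i) j" "cell_vals V lo3 i j \<le> V i (Suc j)"
  "V i j \<le> cell_vals V hi3 i j" "V (Suc i) j \<le> cell_vals V hi3 i j" "V i (Suc j) \<le> cell_vals V hi3 i j"
  by (auto simp: cell_vals_def lo3_def hi3_def)

lemma cell_vals_hi3_le: "cell_vals V hi3 i j \<le> cell_vals V lo3 i j + 2 * cell_vals V gap3 i j"
  using range_le_gap3 by (auto simp: cell_vals_def algebra_simps)

lemma gap3_le_range: "gap3 x y z \<le> hi3 x y z - lo3 x y z"
  by (auto simp: triple_defs min_def max_def)

lemma range3_le:
  assumes "\<bar>x - y\<bar> \<le> d" "\<bar>x - z\<bar> \<le> d" "\<bar>y - z\<bar> \<le> d"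
  shows "hi3 x y z - lo3 x y z \<le> d"
  using assms by (auto simp: hi3_def lo3_def min_def max_def)

lemma two_powr_minus_nat: "2 powr - real N = 1 / 2 ^ N"
  by (simp add: powr_minus powr_realpow divide_inverse)

text \<open>As \<open>\<alpha> < 1\<close>, the oscillation of a Lipschitz function on cells of side
  \<open>1 / 2 ^ m\<close> is finally small against the Hoelder bound. The \<open>+ 2\<close>
  matches the lower end of the brackets in \<open>dyadic_bracket\<close>.\<close>

lemma large_scale_exists:
  fixes \<alpha> C e :: real
  assumes "0 < \<alpha>" "\<alpha> < 1" "0 < e"
  shows "\<exists>m::nat. C / 2 ^ m \<le> e * 2 powr (- \<alpha> * (real m + 2))"
proof -
  have "(\<lambda>m. (C * 2 powr (2 * \<alpha>)) * (2 powr (\<alpha> - 1)) ^ m) \<longlonglongrightarrow> (C * 2 powr (2 * \<alpha>)) * 0"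
    using assms by (intro tendsto_mult tendsto_const LIMSEQ_power_zero) (auto simp: powr_less_one)
  then have "eventually (\<lambda>m. (C * 2 powr (2 * \<alpha>)) * (2 powr (\<alpha> - 1)) ^ m < e) sequentially"
    using assms by (intro order_tendstoD(2)[where y = "_ * 0"]) auto
  then obtain m where m: "(C * 2 powr (2 * \<alpha>)) * (2 powr (\<alpha> - 1)) ^ m < e"
    using eventually_happens by fastforce
  have "(2 powr (\<alpha> - 1)) ^ m = (2 powr (\<alpha> - 1)) powr real m"
    by (simp add: powr_realpow)
  also have "\<dots> = 2 powr (\<alpha> * m - m)"
    unfolding powr_powr by (simp add: left_diff_distrib)
  finally have *: "(2 powr (\<alpha> - 1)) ^ m = 2 powr (\<alpha> * m) / 2 ^ m"
    by (simp add: powr_diff powr_realpow)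
  have "C / 2 ^ m = ((C * 2 powr (2 * \<alpha>)) * (2 powr (\<alpha> - 1)) ^ m) * 2 powr (- \<alpha> * (real m + 2))"
  proof -
    have "2 powr (2 * \<alpha>) * 2 powr (\<alpha> * m) * 2 powr (- \<alpha> * (real m + 2)) = 1"
      by (simp add: algebra_simps flip: powr_add)
    then have "C / 2 ^ m * (2 powr (2 * \<alpha>) * 2 powr (\<alpha> * m) * 2 powr (- \<alpha> * (real m + 2))) = C / 2 ^ m"
      by simp
    then show ?thesis unfolding * by (simp add: mult_ac)
  qed
  also have "\<dots> \<le> e * 2 powr (- \<alpha> * (real m + 2))"
    using m by (intro mult_right_mono) auto
  finally show ?thesis by blast
qed

lemma dyadic_bracket:
  fixes D :: real
  assumes "0 < D" "D \<le> 1 / 2 ^ Suc m"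
  obtains n where "1 / 2 ^ Suc (Suc (m + n)) < D" "D \<le> 1 / 2 ^ Suc (m + n)"
proof -
  obtain N where "(1 / 2) ^ N < D"
    using real_arch_pow_inv[OF assms(1), of "1 / 2"] by auto
  then have N: "1 / 2 ^ N < D" by (simp add: power_one_over)
  define P where "P n \<longleftrightarrow> 1 / 2 ^ Suc (Suc (m + n)) < D" for n
  have "1 / 2 ^ Suc (Suc (m + N)) \<le> (1::real) / 2 ^ N"
    by (intro divide_left_mono power_increasing) auto
  then have ex: "P N" using N by (simp add: P_def)
  define n where "n = (LEAST n. P n)"
  have 1: "P n" unfolding n_def using ex by (rule LeastI)
  have "D \<le> 1 / 2 ^ Suc (m + n)"
  proof (cases n)
    case 0 then show ?thesis using assms by simp
  next
    case (Suc n')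
    then have "\<not> P n'" unfolding n_def by (metis lessI not_less_Least)
    then show ?thesis using Suc by (simp add: P_def)
  qed
  then show thesis using that 1 by (simp add: P_def)
qed

lemma covering_number_le:
  assumes "finite C" "A \<subseteq> \<Union>C" "\<And>U. U \<in> C \<Longrightarrow> bounded U \<and> diameter U \<le> \<delta>"
  shows "covering_number \<delta> A \<le> card C"
  unfolding covering_number_def by (rule Least_le) (use assms in blast)

section \<open>Existence, modulus of continuity and level sets\<close>

context equilateral
begin

abbreviation "\<Delta> \<equiv> sierpinski_triangle a b c"

text \<open>A point can lie in several cells of a level; one suitable cell per level is enough,
  because cells containing nearby points share a corner.\<close>

definition follows :: "nat \<Rightarrow> nat \<Rightarrow> nat \<Rightarrow> (nat \<Rightarrow> nat \<Rightarrow> real) \<Rightarrow> ('a \<Rightarrow> real) \<Rightarrow> bool" where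
  "follows m l k V f \<longleftrightarrow> (\<forall>x\<in>\<Delta>. \<forall>n. \<exists>(i, j)\<in>cells (m + n). x \<in> tri a b c (m + n) i j \<and>
      f x \<in> {cell_vals (fst (conf l k V n)) lo3 i j .. cell_vals (fst (conf l k V n)) hi3 i j})"

lemma followsE:
  assumes "follows m l k V f" "x \<in> \<Delta>"
  obtains i j where "(i, j) \<in> cells (m + n)" "x \<in> tri a b c (m + n) i j"
    "cell_vals (fst (conf l k V n)) lo3 i j \<le> f x" "f x \<le> cell_vals (fst (conf l k V n)) hi3 i j"
  using assms unfolding follows_def by fastforce

text \<open>At a fixed point the unions \<open>K n\<close> of the ranges of the cells containing it
  form a decreasing sequence of nonempty compact sets. Any common element can serve as the value
  there.\<close>

lemma follows_exists:
  assumes V: "\<And>i j. (i, j) \<in> cells m \<Longrightarrow> cell_vals V gap3 i j \<le> H"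
    and H: "0 \<le> H" and l: "2 * k + 1 \<le> l"
  shows "\<exists>f. follows m l k V f"
proof -
  have "\<exists>r. \<forall>n. \<exists>(i, j)\<in>cells (m + n). x \<in> tri a b c (m + n) i j \<and>
      r \<in> {cell_vals (fst (conf l k V n)) lo3 i j .. cell_vals (fst (conf l k V n)) hi3 i j}"
    if x: "x \<in> \<Delta>" for x
  proof -
    define I where "I n = {(i, j) \<in> cells (m + n). x \<in> tri a b c (m + n) i j}" for n
    define K where "K n = (\<Union>(i, j)\<in>I n.
      {cell_vals (fst (conf l k V n)) lo3 i j .. cell_vals (fst (conf l k V n)) hi3 i j})" for n
    have fin: "finite (I n)" for n unfolding I_def by (rule finite_subset[OF _ finite_cells[of "m + n"]]) auto
    have comp: "compact (K n)" for n unfolding K_def by (intro compact_UN fin) auto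
    have ne: "K n \<noteq> {}" for n
    proof -
      obtain i j where "(i, j) \<in> cells (m + n)" "x \<in> tri a b c (m + n) i j"
        using x by (rule sierpinski_cell)
      then have "fst (conf l k V n) i j \<in> K n"
        unfolding K_def I_def using cell_vals_range(1,4) by fastforce
      then show ?thesis by auto
    qed
    have step: "K (Suc n) \<subseteq> K n" for n
    proof
      fix r assume "r \<in> K (Suc n)"
      then obtain p q where pq: "(p, q) \<in> cells (Suc (m + n))" "x \<in> tri a b c (Suc (m + n)) p q"
        "cell_vals (fst (conf l k V (Suc n))) lo3 p q \<le> r" "r \<le> cell_vals (fst (conf l k V (Suc n))) hi3 p q"
        unfolding K_def I_def by (auto simp del: conf.simps cells.simps)
      obtain i j where ij: "(i, j) \<in> cells (m + n)"
        "(p, q) = (2 * i, 2 * j) \<or> (p, q) = (Suc (2 * i), 2 * j) \<or> (p, q) = (2 * i, Suc (2 * j))"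
        using pq(1) by (rule cells_SucE)
      have "x \<in> tri a b c (m + n) i j" using tri_child_subset[OF ij(2)] pq(2) by blast
      then have "(i, j) \<in> I n" using ij by (simp add: I_def)
      moreover have "cell_vals (fst (conf l k V n)) lo3 i j \<le> r" "r \<le> cell_vals (fst (conf l k V n)) hi3 i j"
        using conf_vals_between[OF V H l ij] pq(3,4) by linarith+
      ultimately show "r \<in> K n" unfolding K_def by force
    qed
    have "\<Inter>(range K) \<noteq> {}"
    proof (rule compact_nest)
      show "K n \<subseteq> K m" if "m \<le> n" for m n using step that by (rule lift_Suc_antimono_le)
    qed (use comp ne in auto)
    then obtain r where "\<And>n. r \<in> K n" by auto
    then show ?thesis unfolding K_def I_def by (intro exI[of _ r]) fastforce
  qed
  then show ?thesis unfolding follows_def by (intro bchoice) blast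
qed

text \<open>Two points at most half a side apart lie in cells with a common corner. At each of them
  \<open>f\<close> differs from the value at that corner by at most the range of the cell, which is
  at most \<open>2 * B\<close>.\<close>

lemma follows_modulus:
  assumes f: "follows m l k V f" and xy: "x \<in> \<Delta>" "y \<in> \<Delta>"
    and B: "\<And>i j. (i, j) \<in> cells (m + n) \<Longrightarrow> cell_vals (fst (conf l k V n)) gap3 i j \<le> B"
    and d: "dist x y \<le> 1 / 2 ^ Suc (m + n)"
  shows "\<bar>f x - f y\<bar> \<le> 4 * B"
proof -
  define W where "W = fst (conf l k V n)"
  obtain i j where ij: "(i, j) \<in> cells (m + n)" "x \<in> tri a b c (m + n) i j"
    "cell_vals W lo3 i j \<le> f x" "f x \<le> cell_vals W hi3 i j"
    using followsE[OF f xy(1)] unfolding W_def by metis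
  obtain i' j' where ij': "(i', j') \<in> cells (m + n)" "y \<in> tri a b c (m + n) i' j'"
    "cell_vals W lo3 i' j' \<le> f y" "f y \<le> cell_vals W hi3 i' j'"
    using followsE[OF f xy(2)] unfolding W_def by metis
  obtain p q where pq: "(p, q) \<in> corners i j" "(p, q) \<in> corners i' j'"
    using common_corner[OF ij(2) ij'(2) d] .
  have "cell_vals W lo3 i j \<le> W p q" "W p q \<le> cell_vals W hi3 i j"
    "cell_vals W lo3 i' j' \<le> W p q" "W p q \<le> cell_vals W hi3 i' j'"
    using pq cell_vals_range[of W] by (auto simp: corners_def)
  moreover have "cell_vals W hi3 i j \<le> cell_vals W lo3 i j + 2 * B"
    "cell_vals W hi3 i' j' \<le> cell_vals W lo3 i' j' + 2 * B"
    using B[OF ij(1)] B[OF ij'(1)] cell_vals_hi3_le[of W i j] cell_vals_hi3_le[of W i' j']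
    unfolding W_def by linarith+
  ultimately show ?thesis using ij ij' by linarith
qed

text \<open>If \<open>g x = r\<close>, then \<open>f x\<close> is closer than \<open>\<eta>\<close>
  to \<open>r\<close> and lies in the range of a cell at \<open>x\<close>. The ends of that range
  are vertex values, at distance at least \<open>\<eta>\<close> from \<open>r\<close>, so
  \<open>r\<close> is strictly inside. Such cells have weight at least \<open>1\<close>, and
  \<open>conf_weight\<close> bounds their number.\<close>

lemma follows_cover:
  assumes f: "follows m l k V f"
    and V: "\<And>i j. (i, j) \<in> cells m \<Longrightarrow> cell_vals V gap3 i j \<le> H"
    and H: "0 \<le> H" and l: "2 * k + 1 \<le> l"
    and g: "\<And>x. x \<in> \<Delta> \<Longrightarrow> \<bar>g x - f x\<bar> < \<eta>"
    and r: "\<And>i j p q. (i, j) \<in> cells (m + n) \<Longrightarrow> (p, q) \<in> corners i j \<Longrightarrow>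
       \<eta> \<le> \<bar>r - fst (conf l k V n) p q\<bar>"
  shows "covering_number (1 / 2 ^ (m + n)) {x \<in> \<Delta>. g x = r} \<le> 3 ^ m * 2 ^ (k * Suc (n div l))"
proof -
  define W where "W = fst (conf l k V n)"
  define \<sigma> where "\<sigma> = snd (conf l k V n)"
  define I where "I = {(i, j) \<in> cells (m + n). cell_vals W lo3 i j < r \<and> r < cell_vals W hi3 i j}"
  have I: "I \<subseteq> cells (m + n)" by (auto simp: I_def)
  then have fin: "finite I" by (rule finite_subset) simp
  have "{x \<in> \<Delta>. g x = r} \<subseteq> (\<Union>(i, j)\<in>I. tri a b c (m + n) i j)"
  proof clarify
    fix x assume x: "x \<in> \<Delta>" "r = g x"
    obtain i j where ij: "(i, j) \<in> cells (m + n)" "x \<in> tri a b c (m + n) i j"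
      "cell_vals W lo3 i j \<le> f x" "f x \<le> cell_vals W hi3 i j"
      using followsE[OF f x(1)] unfolding W_def by metis
    have *: "\<eta> \<le> \<bar>r - W i j\<bar>" "\<eta> \<le> \<bar>r - W (Suc i) j\<bar>" "\<eta> \<le> \<bar>r - W i (Suc j)\<bar>"
      using r[OF ij(1)] unfolding W_def by (auto simp: corners_def)
    have **: "\<eta> \<le> \<bar>r - cell_vals W lo3 i j\<bar>" "\<eta> \<le> \<bar>r - cell_vals W hi3 i j\<bar>"
      using * by (auto simp: cell_vals_def lo3_def hi3_def min_def max_def)
    have "\<bar>r - f x\<bar> < \<eta>" using g[OF x(1)] x(2) by simp
    then have "cell_vals W lo3 i j < r \<and> r < cell_vals W hi3 i j" using ** ij(3,4) by linarith
    then show "x \<in> (\<Union>(i, j)\<in>I. tri a b c (m + n) i j)" using ij by (auto simp: I_def)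
  qed
  then have "covering_number (1 / 2 ^ (m + n)) {x \<in> \<Delta>. g x = r} \<le> card ((\<lambda>(i, j). tri a b c (m + n) i j) ` I)"
    by (intro covering_number_le) (use fin diameter_tri in auto)
  also have "\<dots> \<le> card I" using fin by (rule card_image_le)
  also have "\<dots> = (\<Sum>(i, j)\<in>I. 1)" by simp
  also have "\<dots> \<le> (\<Sum>(i, j)\<in>I. cell_weight r W \<sigma> i j)"
    by (intro sum_mono) (auto simp: I_def cell_weight_def cell_vals_def weight_def)
  also have "\<dots> \<le> (\<Sum>(i, j)\<in>cells (m + n). cell_weight r W \<sigma> i j)"
    by (intro sum_mono2 I) auto
  also have "\<dots> \<le> 3 ^ m * 2 ^ (k * Suc (n div l))"
    unfolding W_def \<sigma>_def by (rule conf_weight[OF V H l])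
  finally show ?thesis .
qed

text \<open>Below half the mesh of level \<open>m\<close> the Hoelder bound comes from
  \<open>conf_gap\<close>; above it, it is inherited from \<open>f1\<close>, whose slack
  \<open>e\<close> pays for replacing \<open>f1\<close> by \<open>f\<close>. The depth
  \<open>n\<close> is chosen only after \<open>m\<close>, so that the cost of the first
  \<open>m\<close> levels becomes negligible.\<close>

lemma frugal_approximation:
  fixes \<alpha> \<beta> \<beta>' L e \<epsilon> :: real and f1 :: "'a \<Rightarrow> real" and k l :: nat
  assumes \<alpha>: "0 < \<alpha>" "\<alpha> < 1" and l: "2 * k + 1 \<le> l"
    and M: "2 powr (\<alpha> * l) \<le> 2 ^ k * real ((l - 1 - k) choose k)"
    and \<beta>: "real k \<le> \<beta>' * l" "\<beta>' < \<beta>"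
    and L: "\<And>x y. \<bar>f1 x - f1 y\<bar> \<le> L * dist x y"
    and e: "0 < e" "e \<le> 1" and hol: "\<And>x y. \<bar>f1 x - f1 y\<bar> \<le> (1 - e) * dist x y powr \<alpha>"
    and \<epsilon>: "0 < \<epsilon>"
  obtains f \<delta> \<eta> B where
    "\<forall>x\<in>\<Delta>. \<forall>y\<in>\<Delta>. \<bar>f x - f y\<bar> \<le> dist x y powr \<alpha>" "\<forall>x\<in>\<Delta>. \<bar>f x - f1 x\<bar> \<le> \<epsilon>"
    "0 < \<delta>" "\<delta> < \<epsilon>" "0 < \<eta>" "B \<in> sets lborel" "emeasure lborel B < ennreal \<epsilon>"
    "\<forall>g. (\<forall>x\<in>\<Delta>. \<bar>g x - f x\<bar> < \<eta>) \<longrightarrow>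
       (\<forall>r. r \<notin> B \<longrightarrow> real (covering_number \<delta> {x \<in> \<Delta>. g x = r}) \<le> \<delta> powr - \<beta>)"
proof -
  have L0: "0 \<le> L" using L[of a b] sides by simp
  \<comment> \<open>A factor \<open>4\<close> is lost in \<open>follows_modulus\<close> and
    \<open>4 ^ l\<close> in \<open>conf_gap\<close>, so that \<open>C / 2 ^ m\<close> is the total
    loss at level \<open>m\<close>.\<close>
  define C where "C = 4 * L * 4 ^ l"
  obtain m :: nat where m: "C / 2 ^ m \<le> min e \<epsilon> * 2 powr (- \<alpha> * (real m + 2))"
    using large_scale_exists[of \<alpha> "min e \<epsilon>" C] \<alpha> e \<epsilon> by auto
  define V where "V i j = f1 (vert a b c m i j)" for i j
  define H where "H = L / 2 ^ m"
  have H: "0 \<le> H" using L0 by (simp add: H_def)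
  have range: "cell_vals V hi3 i j - cell_vals V lo3 i j \<le> H" for i j
    unfolding cell_vals_def V_def H_def
    using L[of "vert a b c m i j" "vert a b c m (Suc i) j"] L[of "vert a b c m i j" "vert a b c m i (Suc j)"]
      L[of "vert a b c m (Suc i) j" "vert a b c m i (Suc j)"] dist_vert[of m i j]
    by (intro range3_le) auto
  have V: "cell_vals V gap3 i j \<le> H" for i j
    using range[of i j] gap3_le_range unfolding cell_vals_def by (meson order_trans)
  obtain f where f: "follows m l k V f" using follows_exists[OF V H l] by auto
  have C4: "4 * H \<le> C / 2 ^ m" "C / 2 ^ m = 4 * (H * 4 ^ l)"
  proof -
    have "H * 1 \<le> H * 4 ^ l" using H by (intro mult_left_mono) auto
    then show "4 * H \<le> C / 2 ^ m" by (simp add: C_def H_def)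
  qed (simp add: C_def H_def)
  have close: "\<bar>f x - f1 x\<bar> \<le> 2 * H" if x: "x \<in> \<Delta>" for x
  proof -
    obtain i j where ij: "x \<in> tri a b c m i j" "cell_vals V lo3 i j \<le> f x" "f x \<le> cell_vals V hi3 i j"
      by (rule followsE[OF f x, of 0]) (auto simp del: cells.simps)
    have "\<bar>f x - V i j\<bar> \<le> H" using ij cell_vals_range(1,4)[of V i j] range[of i j] by linarith
    moreover have "\<bar>V i j - f1 x\<bar> \<le> H"
    proof -
      have "vert a b c m i j \<in> tri a b c m i j" unfolding tri_def by (auto intro: hull_inc)
      then have "L * dist (vert a b c m i j) x \<le> L * (1 / 2 ^ m)"
        using ij dist_in_tri L0 by (intro mult_left_mono) auto
      then show ?thesis using L[of "vert a b c m i j" x] by (simp add: V_def H_def)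
    qed
    ultimately show ?thesis by linarith
  qed
  have small: "2 powr (- \<alpha> * (real m + 2)) \<le> 1" using \<alpha> powr_mono[of "- \<alpha> * (real m + 2)" 0 2] by simp
  have hf: "\<bar>f x - f y\<bar> \<le> dist x y powr \<alpha>" if x: "x \<in> \<Delta>" and y: "y \<in> \<Delta>" for x y
  proof -
    define D where "D = dist x y"
    consider "D = 0" | "0 < D" "D \<le> 1 / 2 ^ Suc m" | "1 / 2 ^ Suc m < D"
      using zero_le_dist[of x y] unfolding D_def by linarith
    then show ?thesis
    proof cases
      case 1 then show ?thesis by (simp add: D_def)
    next
      case 2
      then obtain n where n: "1 / 2 ^ Suc (Suc (m + n)) < D" "D \<le> 1 / 2 ^ Suc (m + n)"
        by (rule dyadic_bracket)
      have "\<bar>f x - f y\<bar> \<le> 4 * (H * 4 ^ l * 2 powr (- \<alpha> * n))"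
        using follows_modulus[OF f x y _ n(2)[unfolded D_def]] conf_gap[OF V H l _ M \<alpha>(1)] by blast
      also have "\<dots> = (C / 2 ^ m) * 2 powr (- \<alpha> * n)" unfolding C4(2) by simp
      also have "\<dots> \<le> (1 * 2 powr (- \<alpha> * (real m + 2))) * 2 powr (- \<alpha> * n)"
      proof (intro mult_right_mono)
        have "min e \<epsilon> * 2 powr (- \<alpha> * (real m + 2)) \<le> 1 * 2 powr (- \<alpha> * (real m + 2))"
          using e by (intro mult_right_mono) auto
        then show "C / 2 ^ m \<le> 1 * 2 powr (- \<alpha> * (real m + 2))" using m by linarith
      qed simp
      also have "\<dots> = 2 powr (- \<alpha> * (real m + 2 + real n))"
        by (simp add: distrib_left flip: powr_add)
      also have "\<dots> = (1 / 2 ^ Suc (Suc (m + n))) powr \<alpha>"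
      proof -
        have "(1::real) / 2 ^ Suc (Suc (m + n)) = 2 powr (- (real m + 2 + real n))"
          using two_powr_minus_nat[of "Suc (Suc (m + n))"] by (simp add: add_ac)
        then show ?thesis by (simp only: powr_powr) (simp add: algebra_simps)
      qed
      also have "\<dots> \<le> D powr \<alpha>" using n \<alpha> by (intro powr_mono2) auto
      finally show ?thesis by (simp add: D_def)
    next
      case 3
      have "\<bar>f x - f y\<bar> \<le> \<bar>f1 x - f1 y\<bar> + 4 * H" using close[OF x] close[OF y] by linarith
      also have "\<dots> \<le> (1 - e) * D powr \<alpha> + e * 2 powr (- \<alpha> * (real m + 2))"
      proof -
        have "min e \<epsilon> * 2 powr (- \<alpha> * (real m + 2)) \<le> e * 2 powr (- \<alpha> * (real m + 2))"
          by (intro mult_right_mono) auto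
        then show ?thesis using hol[of x y] m C4(1) unfolding D_def by linarith
      qed
      also have "2 powr (- \<alpha> * (real m + 2)) \<le> D powr \<alpha>"
      proof -
        have "2 powr (- \<alpha> * (real m + 2)) = (2 powr (- (real m + 2))) powr \<alpha>"
          by (simp add: powr_powr algebra_simps)
        also have "2 powr (- (real m + 2)) = (1::real) / 2 ^ Suc (Suc m)"
          using two_powr_minus_nat[of "Suc (Suc m)"] by (simp add: add_ac)
        also have "(1 / 2 ^ Suc (Suc m)) powr \<alpha> \<le> D powr \<alpha>"
        proof (intro powr_mono2)
          have "(1::real) / 2 ^ Suc (Suc m) \<le> 1 / 2 ^ Suc m" by (intro divide_left_mono) auto
          then show "1 / 2 ^ Suc (Suc m) \<le> D" using 3 by linarith
        qed (use \<alpha> in auto)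
        finally show ?thesis .
      qed
      then have "(1 - e) * D powr \<alpha> + e * 2 powr (- \<alpha> * (real m + 2)) \<le> (1 - e) * D powr \<alpha> + e * D powr \<alpha>"
        using e by (intro add_left_mono mult_left_mono) auto
      finally show ?thesis by (simp add: D_def algebra_simps)
    qed
  qed
  have cf: "\<bar>f x - f1 x\<bar> \<le> \<epsilon>" if x: "x \<in> \<Delta>" for x
  proof -
    have "min e \<epsilon> * 2 powr (- \<alpha> * (real m + 2)) \<le> \<epsilon> * 1"
      using small e \<epsilon> by (intro mult_mono) auto
    then show ?thesis using close[OF x] m C4(1) H by linarith
  qed
  \<comment> \<open>Since \<open>\<beta>' < \<beta>\<close>, the fixed factor
    \<open>3 ^ m * 2 ^ k\<close> is beaten by \<open>2 powr ((\<beta> - \<beta>') * n)\<close> for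
    large \<open>n\<close>.\<close>
  have "\<exists>n. 1 / 2 ^ (m + n) < \<epsilon> \<and> 3 ^ m * 2 ^ k * 2 powr (\<beta>' * n) \<le> 2 powr (\<beta> * (m + n))"
  proof -
    have "0 \<le> \<beta>' * real l" using \<beta>(1) of_nat_0_le_iff order_trans by blast
    then have "\<beta>' \<ge> 0" using l by (simp add: zero_le_mult_iff)
    then have b0: "\<beta> > 0" using \<beta> by simp
    have "(\<lambda>n. (2 powr (\<beta>' - \<beta>)) ^ n) \<longlonglongrightarrow> 0"
      using \<beta> by (intro LIMSEQ_power_zero) (auto simp: powr_less_one)
    then have "eventually (\<lambda>n. (2 powr (\<beta>' - \<beta>)) ^ n < 1 / (3 ^ m * 2 ^ k)) sequentially"
      by (rule order_tendstoD(2)) simp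
    moreover have "(\<lambda>n. (1 / 2) ^ n :: real) \<longlonglongrightarrow> 0" by (intro LIMSEQ_power_zero) simp
    then have "eventually (\<lambda>n. (1 / 2 :: real) ^ n < \<epsilon>) sequentially"
      using \<epsilon> by (rule order_tendstoD(2))
    ultimately have "eventually (\<lambda>n. (2 powr (\<beta>' - \<beta>)) ^ n < 1 / (3 ^ m * 2 ^ k) \<and> (1 / 2 :: real) ^ n < \<epsilon>) sequentially"
      by (rule eventually_conj)
    then obtain n where n: "(2 powr (\<beta>' - \<beta>)) ^ n < 1 / (3 ^ m * 2 ^ k)" "(1 / 2 :: real) ^ n < \<epsilon>"
      using eventually_happens by fastforce
    have "1 / 2 ^ (m + n) \<le> (1 :: real) / 2 ^ n" by (intro divide_left_mono power_increasing) auto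
    then have 1: "1 / 2 ^ (m + n) < \<epsilon>" using n(2) by (simp add: power_one_over)
    have "(2 powr (\<beta>' - \<beta>)) ^ n = (2 powr (\<beta>' - \<beta>)) powr real n" by (simp add: powr_realpow)
    also have "\<dots> = 2 powr (\<beta>' * n - \<beta> * n)" unfolding powr_powr by (simp add: left_diff_distrib)
    finally have "2 powr (\<beta>' * n) / 2 powr (\<beta> * n) < 1 / (3 ^ m * 2 ^ k)" using n(1) by (simp add: powr_diff)
    then have "3 ^ m * 2 ^ k * 2 powr (\<beta>' * n) \<le> 2 powr (\<beta> * n)" by (simp add: field_simps)
    also have "\<dots> \<le> 2 powr (\<beta> * (m + n))" using b0 by (intro powr_mono) (auto simp: distrib_left)
    finally show ?thesis using 1 by auto
  qed
  then obtain n where n: "1 / 2 ^ (m + n) < \<epsilon>" "3 ^ m * 2 ^ k * 2 powr (\<beta>' * n) \<le> 2 powr (\<beta> * (m + n))"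
    by auto
  define \<delta> :: real where "\<delta> = 1 / 2 ^ (m + n)"
  define P where "P = (\<lambda>(p, q). fst (conf l k V n) p q) ` (\<Union>(i, j)\<in>cells (m + n). corners i j)"
  have finP: "finite P" unfolding P_def
    by (intro finite_imageI finite_UN_I) (auto simp: corners_def)
  \<comment> \<open>The closed \<open>\<eta>\<close>-intervals around the finitely many vertex
    values then have total length below \<open>\<epsilon>\<close>; the \<open>+ 1\<close> keeps the
    denominator positive.\<close>
  define \<eta> where "\<eta> = \<epsilon> / (4 * (real (card P) + 1))"
  have \<eta>: "0 < \<eta>" using \<epsilon> by (simp add: \<eta>_def)
  define B where "B = (\<Union>p\<in>P. {p - \<eta> .. p + \<eta>})"
  have "emeasure lborel B \<le> (\<Sum>p\<in>P. emeasure lborel {p - \<eta> .. p + \<eta>})"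
    unfolding B_def by (intro emeasure_subadditive_finite finP) auto
  also have "\<dots> = (\<Sum>p\<in>P. ennreal (2 * \<eta>))" using \<eta> by (intro sum.cong) auto
  also have "\<dots> = ennreal (real (card P) * (2 * \<eta>))"
    using \<eta> by (simp add: ennreal_of_nat_eq_real_of_nat ennreal_mult)
  also have "\<dots> < ennreal \<epsilon>"
  proof (rule ennreal_lessI[OF \<epsilon>])
    have "real (card P) * (2 * \<eta>) = \<epsilon> * (real (card P) / (2 * (real (card P) + 1)))"
      by (simp add: \<eta>_def field_simps)
    also have "\<dots> < \<epsilon> * 1" using \<epsilon> by (intro mult_strict_left_mono) auto
    finally show "real (card P) * (2 * \<eta>) < \<epsilon>" by simp
  qed
  finally have Bm: "emeasure lborel B < ennreal \<epsilon>" .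
  have Bs: "B \<in> sets lborel" unfolding B_def using finP by (intro sets.finite_UN) auto
  have cov: "real (covering_number \<delta> {x \<in> \<Delta>. g x = r}) \<le> \<delta> powr - \<beta>"
    if g: "\<And>x. x \<in> \<Delta> \<Longrightarrow> \<bar>g x - f x\<bar> < \<eta>" and r: "r \<notin> B" for g r
  proof -
    have "\<eta> \<le> \<bar>r - fst (conf l k V n) p q\<bar>" if "(i, j) \<in> cells (m + n)" "(p, q) \<in> corners i j" for i j p q
    proof -
      have "fst (conf l k V n) p q \<in> P" unfolding P_def using that by force
      then have "r \<notin> {fst (conf l k V n) p q - \<eta> .. fst (conf l k V n) p q + \<eta>}"
        using r unfolding B_def by blast
      then show ?thesis by auto
    qed
    then have "covering_number \<delta> {x \<in> \<Delta>. g x = r} \<le> 3 ^ m * 2 ^ (k * Suc (n div l))"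
      unfolding \<delta>_def using follows_cover[OF f V H l g] by blast
    then have "real (covering_number \<delta> {x \<in> \<Delta>. g x = r}) \<le> real (3 ^ m * 2 ^ (k * Suc (n div l)))"
      by (rule of_nat_mono)
    also have "\<dots> = 3 ^ m * 2 ^ k * 2 powr (real k * real (n div l))"
      by (simp add: powr_realpow power_add flip: of_nat_mult) simp
    also have "\<dots> \<le> 3 ^ m * 2 ^ k * 2 powr (\<beta>' * n)"
    proof (intro mult_left_mono powr_mono)
      have "real (n div l) \<le> real n / real l"
        using l div_times_less_eq_dividend[of n l]
        by (simp add: pos_le_divide_eq flip: of_nat_mult)
      then have "real k * real (n div l) \<le> (\<beta>' * l) * (real n / real l)"
        using \<beta> by (intro mult_mono) auto
      also have "\<dots> = \<beta>' * n" using l by simp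
      finally show "real k * real (n div l) \<le> \<beta>' * n" .
    qed auto
    also have "\<dots> \<le> 2 powr (\<beta> * (m + n))" by (rule n(2))
    also have "\<dots> = \<delta> powr - \<beta>"
    proof -
      have "\<delta> = 2 powr - real (m + n)" unfolding \<delta>_def by (rule two_powr_minus_nat[symmetric])
      then show ?thesis by (simp add: powr_powr algebra_simps)
    qed
    finally show ?thesis .
  qed
  show thesis
  proof (rule that[of f \<delta> \<eta> B])
    show "\<forall>g. (\<forall>x\<in>\<Delta>. \<bar>g x - f x\<bar> < \<eta>) \<longrightarrow>
       (\<forall>r. r \<notin> B \<longrightarrow> real (covering_number \<delta> {x \<in> \<Delta>. g x = r}) \<le> \<delta> powr - \<beta>)"
      by (intro allI impI) (rule cov, blast+)
  qed (use hf cf n(1) \<eta> Bs Bm in \<open>auto simp: \<delta>_def\<close>)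
qed

end

section \<open>Dimensions and the category argument\<close>

lemma hausdorff_premeasure_le:
  fixes A :: "'a::metric_space set"
  assumes "finite C" "A \<subseteq> \<Union>C" "\<And>U. U \<in> C \<Longrightarrow> bounded U \<and> diameter U \<le> \<delta>" "0 < s" "0 \<le> \<delta>"
  shows "hausdorff_premeasure s \<delta> A \<le> ennreal (real (card C) * \<delta> powr s)"
proof -
  obtain h where h: "bij_betw h {..<card C} C"
    using ex_bij_betw_nat_finite[OF assms(1)] by (auto simp: atLeast0LessThan)
  \<comment> \<open>The finite cover is padded with empty sets, for which
    \<open>diameter_powr\<close> is \<open>0\<close>.\<close>
  define U where "U i = (if i < card C then h i else {})" for i
  have hC: "h i \<in> C" if "i < card C" for i using h that by (auto simp: bij_betw_def)
  have "A \<subseteq> (\<Union>i. U i)"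
  proof
    fix x assume "x \<in> A"
    then obtain X where "X \<in> C" "x \<in> X" using assms(2) by auto
    then obtain i where "i < card C" "x \<in> h i" using h by (auto simp: bij_betw_def)
    then show "x \<in> (\<Union>i. U i)" by (auto simp: U_def intro!: exI[of _ i])
  qed
  moreover have "bounded (U i) \<and> diameter (U i) \<le> \<delta>" for i
    using assms(3)[OF hC[of i]] assms(5) by (auto simp: U_def)
  ultimately have "hausdorff_premeasure s \<delta> A \<le> (\<Sum>i. diameter_powr s (U i))"
    unfolding hausdorff_premeasure_def by (intro INF_lower) auto
  also have "\<dots> = (\<Sum>i<card C. diameter_powr s (U i))"
    by (rule suminf_finite) (auto simp: U_def diameter_powr_def)
  also have "\<dots> \<le> (\<Sum>i<card C. ennreal (\<delta> powr s))"
  proof (rule sum_mono)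
    fix i assume "i \<in> {..<card C}"
    then have "bounded (h i)" "diameter (h i) \<le> \<delta>" using assms(3)[OF hC[of i]] by auto
    then have "diameter (h i) powr s \<le> \<delta> powr s"
      using assms(4) diameter_ge_0 by (intro powr_mono2) auto
    then show "diameter_powr s (U i) \<le> ennreal (\<delta> powr s)"
      using assms(4) by (auto simp: diameter_powr_def U_def intro: ennreal_leI)
  qed
  also have "\<dots> = ennreal (real (card C) * \<delta> powr s)"
    by (simp add: ennreal_of_nat_eq_real_of_nat ennreal_mult)
  finally show ?thesis .
qed

text \<open>The \<open>LEAST\<close> ranges over a nonempty set: the closure of a bounded set is
  compact and has a finite cover by balls of radius \<open>\<delta> / 2\<close>.\<close>

lemma covering_number_attained:
  fixes A :: "'a::euclidean_space set"
  assumes "bounded A" "0 < \<delta>"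
  obtains C where "finite C" "card C = covering_number \<delta> A" "A \<subseteq> \<Union>C"
    "\<And>U. U \<in> C \<Longrightarrow> bounded U \<and> diameter U \<le> \<delta>"
proof -
  let ?P = "\<lambda>n. \<exists>C. finite C \<and> card C = n \<and> A \<subseteq> \<Union>C \<and> (\<forall>U\<in>C. bounded U \<and> diameter U \<le> \<delta>)"
  have "compact (closure A)" using assms by (simp add: compact_closure)
  then obtain F where F: "finite F" "closure A \<subseteq> (\<Union>x\<in>F. ball x (\<delta> / 2))"
    using assms compact_eq_totally_bounded by (metis half_gt_zero_iff)
  have "?P (card ((\<lambda>x. ball x (\<delta> / 2)) ` F))"
    using F assms closure_subset[of A] by (intro exI[of _ "(\<lambda>x. ball x (\<delta> / 2)) ` F"]) auto
  then have "?P (covering_number \<delta> A)" unfolding covering_number_def by (rule LeastI)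
  then show thesis using that by auto
qed

lemma premeasure_mono_delta:
  assumes "\<delta> \<le> \<delta>'"
  shows "hausdorff_premeasure s \<delta>' A \<le> hausdorff_premeasure s \<delta> A"
  unfolding hausdorff_premeasure_def by (rule INF_superset_mono) (use assms in \<open>auto intro: order_trans\<close>)

lemma lower_box_dim_nonneg: "0 \<le> lower_box_dim A"
  unfolding lower_box_dim_def
proof (rule Liminf_bounded)
  have "eventually (\<lambda>\<delta>::real. 0 < \<delta> \<and> \<delta> < 1) (at_right 0)"
    using eventually_at_right_less[of "0::real"] eventually_at_right_real[of 0 1]
    by (auto elim: eventually_mono)
  then show "\<forall>\<^sub>F \<delta>::real in at_right 0. 0 \<le> ereal (ln (real (covering_number \<delta> A)) / - ln \<delta>)"
  proof eventually_elim
    case (elim \<delta>)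
    have "0 \<le> ln (real (covering_number \<delta> A))"
      by (cases "covering_number \<delta> A") auto
    moreover have "0 < - ln \<delta>" using elim by simp
    ultimately have "0 \<le> ln (real (covering_number \<delta> A)) / - ln \<delta>" by (rule divide_nonneg_pos)
    then show ?case by (simp only: zero_ereal_def ereal_less_eq)
  qed
qed

lemma lower_box_dim_frequently:
  assumes "lower_box_dim A < ereal s" "0 < \<epsilon>"
  obtains \<delta> where "0 < \<delta>" "\<delta> < \<epsilon>" "real (covering_number \<delta> A) \<le> \<delta> powr - s"
proof -
  have s: "0 < s" using lower_box_dim_nonneg[of A] assms(1) by (metis ereal_less(2) order_le_less_trans)
  have "\<not> (\<forall>\<^sub>F \<delta>::real in at_right 0. ereal s \<le> ereal (ln (real (covering_number \<delta> A)) / - ln \<delta>))"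
    using Liminf_bounded[of "ereal s" "\<lambda>\<delta>. ereal (ln (real (covering_number \<delta> A)) / - ln \<delta>)" "at_right 0"]
      assms(1) unfolding lower_box_dim_def by (auto simp: not_le[symmetric])
  then have "\<exists>\<^sub>F \<delta>::real in at_right 0. ln (real (covering_number \<delta> A)) / - ln \<delta> < s"
    by (simp add: frequently_def not_less)
  moreover have "eventually (\<lambda>\<delta>::real. 0 < \<delta> \<and> \<delta> < min 1 \<epsilon>) (at_right 0)"
    using eventually_at_right_real[of 0 "min 1 \<epsilon>"] assms(2) by (auto elim: eventually_mono)
  ultimately obtain \<delta> :: real where \<delta>: "ln (real (covering_number \<delta> A)) / - ln \<delta> < s" "0 < \<delta>" "\<delta> < 1" "\<delta> < \<epsilon>"
    using frequently_eventually_conj[of _ "at_right (0::real)"] frequently_ex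
    by (metis (mono_tags, lifting) min_less_iff_conj)
  have "real (covering_number \<delta> A) \<le> \<delta> powr - s"
  proof (cases "covering_number \<delta> A = 0")
    case False
    have "ln (real (covering_number \<delta> A)) < s * - ln \<delta>"
      using \<delta> by (subst (asm) pos_divide_less_eq) auto
    then have "ln (real (covering_number \<delta> A)) \<le> ln (\<delta> powr - s)" using \<delta> by (simp add: ln_powr)
    then show ?thesis using False \<delta> by (subst (asm) ln_le_cancel_iff) auto
  qed simp
  then show thesis using that \<delta> by blast
qed

text \<open>For \<open>s < s'\<close> above the lower box dimension, arbitrarily small scales admit
  covers by at most \<open>\<delta> powr - s\<close> sets. Their \<open>s'\<close>-sum is at most
  \<open>\<delta> powr (s' - s)\<close>, which tends to \<open>0\<close>.\<close>

lemma hausdorff_dim_le_lower_box_dim: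
  fixes A :: "'a::euclidean_space set"
  assumes "bounded A"
  shows "hausdorff_dim A \<le> lower_box_dim A"
proof (rule dense_ge)
  fix t assume t: "lower_box_dim A < t"
  then obtain s' where s': "lower_box_dim A < ereal s'" "ereal s' < t"
    using ereal_dense2 by blast
  obtain s where s: "lower_box_dim A < ereal s" "s < s'"
    using ereal_dense2[OF s'(1)] by auto
  have s0: "0 < s" using lower_box_dim_nonneg[of A] s(1) by (metis ereal_less(2) order_le_less_trans)
  have "hausdorff_premeasure s' \<epsilon> A \<le> 0" if \<epsilon>: "0 < \<epsilon>" for \<epsilon>
  proof (rule ennreal_le_epsilon)
    fix e :: real assume e: "0 < e"
    \<comment> \<open>The second bound makes \<open>\<delta> powr (s' - s)\<close> at most
      \<open>e\<close>.\<close>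
    define \<epsilon>' where "\<epsilon>' = min \<epsilon> (e powr (1 / (s' - s)))"
    have "0 < \<epsilon>'" using \<epsilon> e by (simp add: \<epsilon>'_def)
    then obtain \<delta> where \<delta>: "0 < \<delta>" "\<delta> < \<epsilon>'" "real (covering_number \<delta> A) \<le> \<delta> powr - s"
      using lower_box_dim_frequently[OF s(1)] by blast
    obtain C where C: "finite C" "card C = covering_number \<delta> A" "A \<subseteq> \<Union>C"
      "\<And>U. U \<in> C \<Longrightarrow> bounded U \<and> diameter U \<le> \<delta>"
      using covering_number_attained[OF assms \<delta>(1)] by blast
    have "hausdorff_premeasure s' \<epsilon> A \<le> hausdorff_premeasure s' \<delta> A"
      using \<delta> by (intro premeasure_mono_delta) (auto simp: \<epsilon>'_def)
    also have "\<dots> \<le> ennreal (real (card C) * \<delta> powr s')"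
      using C \<delta> s0 s by (intro hausdorff_premeasure_le) auto
    also have "\<dots> \<le> ennreal e"
    proof (rule ennreal_leI)
      have "real (card C) * \<delta> powr s' \<le> \<delta> powr - s * \<delta> powr s'"
        using C \<delta> by (intro mult_right_mono) auto
      also have "\<dots> = \<delta> powr (s' - s)" by (simp flip: powr_add)
      also have "\<dots> \<le> (e powr (1 / (s' - s))) powr (s' - s)"
        using \<delta> s by (intro powr_mono2) (auto simp: \<epsilon>'_def)
      also have "\<dots> = e" using e s by (simp add: powr_powr)
      finally show "real (card C) * \<delta> powr s' \<le> e" .
    qed
    finally show "hausdorff_premeasure s' \<epsilon> A \<le> 0 + ennreal e" by simp
  qed
  then have "hausdorff_measure s' A = 0"
    unfolding hausdorff_measure_def by (auto intro!: antisym SUP_least)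
  then have "hausdorff_dim A \<le> ereal s'"
    unfolding hausdorff_dim_def using s0 s by (intro Inf_lower) auto
  then show "hausdorff_dim A \<le> t" using s'(2) by simp
qed

lemma generic_level_dim_mono:
  fixes F :: "'a::euclidean_space set"
  assumes "\<And>A. A \<subseteq> F \<Longrightarrow> d1 A \<le> d2 A"
  shows "generic_level_dim d1 \<alpha> F \<le> generic_level_dim d2 \<alpha> F"
proof -
  have "level_dim d1 f F \<le> level_dim d2 f F" for f
  proof -
    have "outer_measure_of lborel {r. ereal d \<le> d1 {x \<in> F. f x = r}}
      \<le> outer_measure_of lborel {r. ereal d \<le> d2 {x \<in> F. f x = r}}" for d
      using assms by (intro outer_measure_of_mono) (auto intro: order_trans)
    then show ?thesis unfolding level_dim_def
      by (intro Sup_subset_mono) (auto intro: order_less_le_trans)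
  qed
  then show ?thesis unfolding generic_level_dim_def by (intro SUP_subset_mono INF_superset_mono order_refl)
qed

lemma D_star_le_D_lower_box_star:
  assumes "bounded F"
  shows "D_star \<alpha> F \<le> D_lower_box_star \<alpha> F"
  unfolding D_star_def D_lower_box_star_def
  using hausdorff_dim_le_lower_box_dim bounded_subset[OF assms] by (intro generic_level_dim_mono) auto

section \<open>The Hoelder space as a complete metric space\<close>

lemma holder_space_subset: "mspace (holder_space \<alpha> F) \<subseteq> mspace (cfunspace (top_of_set F) euclidean_metric)"
  by (simp add: holder_space_def)

lemma mdist_holder_space_le:
  assumes "0 \<le> e" "\<And>x. x \<in> F \<Longrightarrow> \<bar>f x - g x\<bar> \<le> e"
  shows "mdist (holder_space \<alpha> F) f g \<le> e"
  unfolding holder_space_def mdist_submetric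
  by (rule mdist_cfunspace_le) (use assms in \<open>auto simp: dist_real_def\<close>)

lemma abs_diff_le_mdist_holder_space:
  assumes "f \<in> mspace (holder_space \<alpha> F)" "g \<in> mspace (holder_space \<alpha> F)" "x \<in> F"
  shows "\<bar>f x - g x\<bar> \<le> mdist (holder_space \<alpha> F) f g"
proof -
  have "mdist euclidean_metric (f x) (g x) \<le> mdist (cfunspace (top_of_set F) euclidean_metric) f g"
    by (rule mdist_cfunspace_imp_mdist_le[where X = "top_of_set F"])
      (use assms holder_space_subset in auto)
  then show ?thesis by (simp add: holder_space_def dist_real_def)
qed

text \<open>The bounded continuous functions form a complete space, and the Hoelder inequality
  survives pointwise limits, so the subspace is sequentially closed.\<close>

lemma mcomplete_holder_space:
  fixes F :: "'a::euclidean_space set"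
  shows "Metric_space.mcomplete (mspace (holder_space \<alpha> F)) (mdist (holder_space \<alpha> F))"
proof -
  let ?C = "cfunspace (top_of_set F) (euclidean_metric :: real metric)"
  let ?H = "holder_space \<alpha> F"
  have dH: "mdist ?H = mdist ?C" by (simp add: holder_space_def)
  interpret S: Submetric "mspace ?C" "mdist ?C" "mspace ?H"
    by (intro Submetric.intro Submetric_axioms.intro Metric_space_mspace_mdist holder_space_subset)
  have "mcomplete_of ?C"
    using Met_TC.mcomplete_cfunspace[where 'a = real]
    by (simp add: mcomplete_iff_complete complete_UNIV Met_TC.Self_def euclidean_metric_def)
  then have "S.mcomplete" by (simp add: mcomplete_of_def)
  then have "S.sub.mcomplete"
  proof (rule S.sequentially_closedin_mcomplete_imp_mcomplete)
    fix \<sigma> :: "nat \<Rightarrow> 'a \<Rightarrow> real" and f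
    assume *: "range \<sigma> \<subseteq> mspace ?H \<and> limitin S.mtopology \<sigma> f sequentially"
    from * have lim: "limitin S.mtopology \<sigma> f sequentially" by (rule conjunct2)
    from * have \<sigma>: "range \<sigma> \<subseteq> mspace ?H" by (rule conjunct1)
    have f: "f \<in> mspace ?C" using lim by (rule S.limitin_mspace)
    have "\<bar>f a - f b\<bar> \<le> dist a b powr \<alpha>" if ab: "a \<in> F" "b \<in> F" for a b
    proof (rule field_le_epsilon)
      fix e :: real assume "0 < e"
      have "\<forall>\<epsilon>>0. \<forall>\<^sub>F n in sequentially. \<sigma> n \<in> mspace ?C \<and> mdist ?C (\<sigma> n) f < \<epsilon>"
        using lim unfolding S.limitin_metric by (rule conjunct2)
      then have "0 < e / 2 \<longrightarrow> (\<forall>\<^sub>F n in sequentially. \<sigma> n \<in> mspace ?C \<and> mdist ?C (\<sigma> n) f < e / 2)"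
        by (rule spec)
      then have "\<forall>\<^sub>F n in sequentially. \<sigma> n \<in> mspace ?C \<and> mdist ?C (\<sigma> n) f < e / 2"
        by (rule mp) (use \<open>0 < e\<close> in simp)
      then obtain n where n: "\<sigma> n \<in> mspace ?C" "mdist ?C (\<sigma> n) f < e / 2"
        using eventually_happens by fastforce
      have "mdist euclidean_metric (\<sigma> n x) (f x) \<le> mdist ?C (\<sigma> n) f" if "x \<in> F" for x
        using n(1) f that by - (rule mdist_cfunspace_imp_mdist_le[where X = "top_of_set F"], simp_all)
      then have "\<bar>\<sigma> n a - f a\<bar> < e / 2" "\<bar>\<sigma> n b - f b\<bar> < e / 2"
        using ab n(2) by (fastforce simp: dist_real_def)+
      moreover have "\<bar>\<sigma> n a - \<sigma> n b\<bar> \<le> dist a b powr \<alpha>"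
        using \<sigma> ab by (auto simp: holder_space_def)
      ultimately show "\<bar>f a - f b\<bar> \<le> dist a b powr \<alpha> + e" by linarith
    qed
    then show "f \<in> mspace ?H" using f by (simp add: holder_space_def)
  qed
  then show ?thesis by (simp add: dH)
qed

section \<open>From single scales to almost every level\<close>

lemma lower_box_dim_le:
  assumes "0 \<le> s"
    and "\<And>\<epsilon>. 0 < \<epsilon> \<Longrightarrow> \<exists>\<delta>. 0 < \<delta> \<and> \<delta> < \<epsilon> \<and> real (covering_number \<delta> A) \<le> \<delta> powr - s"
  shows "lower_box_dim A \<le> ereal s"
proof (rule ccontr)
  assume "\<not> lower_box_dim A \<le> ereal s"
  then have "\<forall>\<^sub>F \<delta> in at_right 0. ereal s < ereal (ln (real (covering_number \<delta> A)) / - ln \<delta>)"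
    unfolding lower_box_dim_def not_le by (rule less_LiminfD)
  then obtain b :: real where b: "0 < b"
    "\<And>\<delta>. 0 < \<delta> \<Longrightarrow> \<delta> < b \<Longrightarrow> s < ln (real (covering_number \<delta> A)) / - ln \<delta>"
    unfolding eventually_at_right_field by auto
  obtain \<delta> where \<delta>: "0 < \<delta>" "\<delta> < min 1 b" "real (covering_number \<delta> A) \<le> \<delta> powr - s"
    using assms(2)[of "min 1 b"] b(1) by auto
  have pos: "0 < - ln \<delta>" using \<delta> by simp
  have "ln (real (covering_number \<delta> A)) \<le> s * - ln \<delta>"
  proof (cases "covering_number \<delta> A = 0")
    case True
    then show ?thesis using assms(1) pos by (simp add: mult_nonneg_nonpos)
  next
    case False
    then have "ln (real (covering_number \<delta> A)) \<le> ln (\<delta> powr - s)"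
      using \<delta> by (subst ln_le_cancel_iff) auto
    then show ?thesis using \<delta> by (simp add: ln_powr)
  qed
  then have "ln (real (covering_number \<delta> A)) / - ln \<delta> \<le> s"
    using pos by (subst pos_divide_le_eq) auto
  with b(2)[of \<delta>] \<delta> show False by simp
qed

text \<open>The condition at one scale that the category argument works with: it holds on a whole
  ball around the functions built above, and having it for every \<open>1 / real (Suc j)\<close>
  bounds \<open>level_dim\<close>.\<close>

definition frugal :: "'a::euclidean_space set \<Rightarrow> real \<Rightarrow> real \<Rightarrow> ('a \<Rightarrow> real) \<Rightarrow> bool" where
  "frugal F \<beta> \<epsilon> f \<longleftrightarrow> (\<exists>\<delta> B. 0 < \<delta> \<and> \<delta> < \<epsilon> \<and> B \<in> sets lborel \<and> emeasure lborel B < ennreal \<epsilon> \<and>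
     (\<forall>r. r \<notin> B \<longrightarrow> real (covering_number \<delta> {x \<in> F. f x = r}) \<le> \<delta> powr - (\<beta> + \<epsilon>)))"

text \<open>Each tail intersection lies in sets of arbitrarily small measure. A level outside the
  union escapes infinitely many \<open>B j\<close>, which is all that a lower limit asks for, so
  measures tending to \<open>0\<close> suffice without summability.\<close>

lemma null_set_liminf:
  assumes "\<And>j. B j \<in> sets M" "\<And>j. emeasure M (B j) < ennreal (1 / real (Suc j))"
  shows "(\<Union>J. \<Inter>j\<in>{J..}. B j) \<in> null_sets M"
proof (rule null_sets_UN)
  fix J
  have m: "(\<Inter>j\<in>{J..}. B j) \<in> sets M" using assms by (intro sets.countable_INT) auto
  have "emeasure M (\<Inter>j\<in>{J..}. B j) \<le> 0"
  proof (rule ennreal_le_epsilon)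
    fix e :: real assume "0 < e"
    then obtain j where j: "1 / real (Suc j) < e" using nat_approx_posE by blast
    have "emeasure M (\<Inter>j\<in>{J..}. B j) \<le> emeasure M (B (max j J))"
      using assms by (intro emeasure_mono) auto
    also have "\<dots> \<le> ennreal (1 / real (Suc (max j J)))" using assms(2) by (rule less_imp_le)
    also have "\<dots> \<le> ennreal e"
    proof (rule ennreal_leI)
      have "1 / real (Suc (max j J)) \<le> 1 / real (Suc j)" by (intro divide_left_mono) auto
      then show "1 / real (Suc (max j J)) \<le> e" using j by linarith
    qed
    finally show "emeasure M (\<Inter>j\<in>{J..}. B j) \<le> 0 + ennreal e" by simp
  qed
  then show "(\<Inter>j\<in>{J..}. B j) \<in> null_sets M" using m by auto
qed

text \<open>For a level outside the null set \<open>N\<close>, the good scales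
  \<open>\<delta> j\<close> tend to \<open>0\<close> along infinitely many \<open>j\<close>, while
  the exponents \<open>\<beta> + 1 / real (Suc j)\<close> tend to \<open>\<beta>\<close>.\<close>

lemma level_dim_le_of_frugal:
  assumes \<beta>: "0 \<le> \<beta>" and f: "\<And>j. frugal F \<beta> (1 / real (Suc j)) f"
  shows "level_dim lower_box_dim f F \<le> ereal \<beta>"
proof -
  define P where "P j \<delta> B \<longleftrightarrow> 0 < \<delta> \<and> \<delta> < 1 / real (Suc j) \<and> B \<in> sets lborel \<and>
    emeasure lborel B < ennreal (1 / real (Suc j)) \<and> (\<forall>r. r \<notin> B \<longrightarrow>
      real (covering_number \<delta> {x \<in> F. f x = r}) \<le> \<delta> powr - (\<beta> + 1 / real (Suc j)))" for j \<delta> B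
  have "\<forall>j. \<exists>\<delta> B. P j \<delta> B" using f unfolding frugal_def P_def by blast
  then obtain \<delta> where "\<forall>j. \<exists>B. P j (\<delta> j) B" by (rule choice[THEN exE])
  then obtain B where "\<forall>j. P j (\<delta> j) (B j)" by (rule choice[THEN exE])
  then have \<delta>: "\<And>j. 0 < \<delta> j" "\<And>j. \<delta> j < 1 / real (Suc j)"
    and B: "\<And>j. B j \<in> sets lborel" "\<And>j. emeasure lborel (B j) < ennreal (1 / real (Suc j))"
    and cov: "\<And>j r. r \<notin> B j \<Longrightarrow>
      real (covering_number (\<delta> j) {x \<in> F. f x = r}) \<le> \<delta> j powr - (\<beta> + 1 / real (Suc j))"
    unfolding P_def by blast+
  define N where "N = (\<Union>J. \<Inter>j\<in>{J..}. B j)"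
  have N: "N \<in> null_sets lborel" unfolding N_def using B by (rule null_set_liminf)
  have box: "lower_box_dim {x \<in> F. f x = r} \<le> ereal \<beta>" if r: "r \<notin> N" for r
  proof (rule ereal_le_epsilon2)
    fix e :: real assume e: "0 < e"
    have "lower_box_dim {x \<in> F. f x = r} \<le> ereal (\<beta> + e)"
    proof (rule lower_box_dim_le)
      fix \<epsilon> :: real assume "0 < \<epsilon>"
      then obtain J where J: "1 / real (Suc J) < min e (min 1 \<epsilon>)"
        using nat_approx_posE[of "min e (min 1 \<epsilon>)"] e by auto
      from r obtain j where j: "j \<ge> J" "r \<notin> B j" unfolding N_def by auto
      have "1 / real (Suc j) \<le> 1 / real (Suc J)" using j by (intro divide_left_mono) auto
      then have "1 / real (Suc j) < min e (min 1 \<epsilon>)" using J by (rule order.strict_trans1)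
      then have s: "1 / real (Suc j) < e" "1 / real (Suc j) < \<epsilon>" "1 / real (Suc j) < 1"
        by (simp_all only: min_less_iff_conj)
      have "real (covering_number (\<delta> j) {x \<in> F. f x = r}) \<le> \<delta> j powr - (\<beta> + 1 / real (Suc j))"
        using cov[OF j(2)] .
      also have "\<dots> \<le> \<delta> j powr - (\<beta> + e)"
        using \<delta>[of j] s by (intro powr_mono') linarith+
      finally show "\<exists>\<delta>. 0 < \<delta> \<and> \<delta> < \<epsilon> \<and> real (covering_number \<delta> {x \<in> F. f x = r}) \<le> \<delta> powr - (\<beta> + e)"
        using \<delta>[of j] s by (intro exI[of _ "\<delta> j"]) auto
    qed (use \<beta> e in simp)
    then show "lower_box_dim {x \<in> F. f x = r} \<le> ereal \<beta> + ereal e" by simp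
  qed
  show ?thesis
    unfolding level_dim_def
  proof (rule Sup_least, clarify)
    fix d assume pos: "0 < outer_measure_of lborel {r. ereal d \<le> lower_box_dim {x \<in> F. f x = r}}"
    show "ereal d \<le> ereal \<beta>"
    proof (rule ccontr)
      assume d: "\<not> ereal d \<le> ereal \<beta>"
      have "{r. ereal d \<le> lower_box_dim {x \<in> F. f x = r}} \<subseteq> N"
      proof
        fix r assume "r \<in> {r. ereal d \<le> lower_box_dim {x \<in> F. f x = r}}"
        then have "ereal d \<le> lower_box_dim {x \<in> F. f x = r}" by simp
        then have "\<not> lower_box_dim {x \<in> F. f x = r} \<le> ereal \<beta>" using d order_trans by blast
        then show "r \<in> N" using box by blast
      qed
      then have "outer_measure_of lborel {r. ereal d \<le> lower_box_dim {x \<in> F. f x = r}} \<le> emeasure lborel N"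
        using N by (metis outer_measure_of_eq outer_measure_of_mono null_setsD2)
      then show False using pos N by auto
    qed
  qed
qed

text \<open>For a supremum of infima it suffices that every dense \<open>G\<close> of the family
  contains one function that is frugal for all \<open>1 / real (Suc j)\<close>. By the Baire
  category theorem, \<open>G\<close> meets the intersection of the dense open sets
  \<open>U j\<close>, which consists of such functions.\<close>

lemma D_lower_box_star_le:
  fixes F :: "'a::euclidean_space set"
  assumes \<beta>: "0 \<le> \<beta>"
    and approx: "\<And>f0 \<epsilon>. f0 \<in> mspace (holder_space \<alpha> F) \<Longrightarrow> 0 < \<epsilon> \<Longrightarrow>
      \<exists>f \<eta>. f \<in> mspace (holder_space \<alpha> F) \<and> (\<forall>x\<in>F. \<bar>f x - f0 x\<bar> \<le> \<epsilon>) \<and> 0 < \<eta> \<and>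
        (\<forall>g. (\<forall>x\<in>F. \<bar>g x - f x\<bar> < \<eta>) \<longrightarrow> frugal F \<beta> \<epsilon> g)"
    and ne: "mspace (holder_space \<alpha> F) \<noteq> {}"
  shows "D_lower_box_star \<alpha> F \<le> ereal \<beta>"
proof -
  define X where "X = holder_space \<alpha> F"
  interpret X: Metric_space "mspace X" "mdist X" by simp
  have top: "mtopology_of X = X.mtopology" by (simp add: mtopology_of_def)
  \<comment> \<open>\<open>\<epsilon> < 1\<close> forces \<open>\<delta> < 1\<close>, so that
    raising the exponent weakens the bound.\<close>
  have frugal_mono: "frugal F \<beta> \<epsilon>' f" if fr: "frugal F \<beta> \<epsilon> f" and le: "\<epsilon> \<le> \<epsilon>'" "\<epsilon> < 1" for \<epsilon> \<epsilon>' f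
  proof -
    obtain \<delta> B where *: "0 < \<delta>" "\<delta> < \<epsilon>" "B \<in> sets lborel" "emeasure lborel B < ennreal \<epsilon>"
     "\<forall>r. r \<notin> B \<longrightarrow> real (covering_number \<delta> {x \<in> F. f x = r}) \<le> \<delta> powr - (\<beta> + \<epsilon>)"
      using fr unfolding frugal_def by blast
    have "\<delta> powr - (\<beta> + \<epsilon>) \<le> \<delta> powr - (\<beta> + \<epsilon>')" using * le by (intro powr_mono') auto
    moreover have "emeasure lborel B < ennreal \<epsilon>'"
      using *(4) le(1) by (meson ennreal_leI order_less_le_trans)
    ultimately show ?thesis
      using * le unfolding frugal_def by (intro exI[of _ \<delta>] exI[of _ B]) (auto intro: order_trans)
  qed
  \<comment> \<open>As a union of balls, \<open>U j\<close> is open whatever the set of all frugal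
    functions looks like.\<close>
  define U where "U j = \<Union>{X.mball f \<rho> | f \<rho>. \<forall>g\<in>X.mball f \<rho>. frugal F \<beta> (1 / real (Suc j)) g}" for j :: nat
  have U_open: "openin X.mtopology (U j)" for j
    unfolding U_def by (rule openin_Union) (auto intro: X.openin_mball)
  have U_frugal: "frugal F \<beta> (1 / real (Suc j)) g" if "g \<in> U j" for g j
    using that unfolding U_def by blast
  have U_dense: "X.mtopology closure_of (U j) = mspace X" for j
  proof -
    have "\<exists>f\<in>U j. f \<in> X.mball f0 e" if f0: "f0 \<in> mspace X" and e: "0 < e" for f0 e
    proof -
      \<comment> \<open>The half makes the distance strictly less than \<open>e\<close>, and
        \<open>Suc (Suc j)\<close> gives \<open>\<epsilon> < 1\<close> also for
        \<open>j = 0\<close>.\<close>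
      define \<epsilon> where "\<epsilon> = min (e / 2) (1 / real (Suc (Suc j)))"
      have "\<epsilon> \<le> 1 / real (Suc (Suc j))" by (simp add: \<epsilon>_def)
      moreover have "1 / real (Suc (Suc j)) \<le> 1 / real (Suc j)" by (intro divide_left_mono) auto
      moreover have "1 / real (Suc (Suc j)) < 1" by simp
      ultimately have \<epsilon>: "0 < \<epsilon>" "\<epsilon> \<le> e / 2" "\<epsilon> \<le> 1 / real (Suc j)" "\<epsilon> < 1"
        using e by (simp add: \<epsilon>_def, simp add: \<epsilon>_def, linarith+)
      obtain f \<eta> where f: "f \<in> mspace X" "\<And>x. x \<in> F \<Longrightarrow> \<bar>f x - f0 x\<bar> \<le> \<epsilon>" "0 < \<eta>"
        "\<And>g. (\<And>x. x \<in> F \<Longrightarrow> \<bar>g x - f x\<bar> < \<eta>) \<Longrightarrow> frugal F \<beta> \<epsilon> g"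
        using approx[of f0 \<epsilon>] f0 \<epsilon> unfolding X_def by blast
      have "mdist X f0 f \<le> \<epsilon>"
        unfolding X_def using \<epsilon> f(2) by (intro mdist_holder_space_le) (auto simp: abs_minus_commute)
      then have 1: "f \<in> X.mball f0 e" using f0 f(1) \<epsilon> e by (auto simp: X.in_mball)
      have fg: "\<forall>g\<in>X.mball f \<eta>. frugal F \<beta> (1 / real (Suc j)) g"
      proof
        fix g assume g: "g \<in> X.mball f \<eta>"
        have "\<bar>g x - f x\<bar> < \<eta>" if "x \<in> F" for x
        proof -
          have "\<bar>g x - f x\<bar> \<le> mdist X g f"
            using g that f(1) unfolding X_def
            by (intro abs_diff_le_mdist_holder_space) (auto simp: X.in_mball[unfolded X_def])
          also have "\<dots> < \<eta>" using g by (auto simp: X.in_mball X.commute)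
          finally show ?thesis .
        qed
        then have "frugal F \<beta> \<epsilon> g" by (rule f(4))
        then show "frugal F \<beta> (1 / real (Suc j)) g" using \<epsilon>(3,4) by (rule frugal_mono)
      qed
      have "X.mball f \<eta> \<in> {X.mball f \<rho> | f \<rho>. \<forall>g\<in>X.mball f \<rho>. frugal F \<beta> (1 / real (Suc j)) g}"
        by (rule CollectI, rule exI[of _ f], rule exI[of _ \<eta>], rule conjI[OF refl fg])
      moreover have "f \<in> X.mball f \<eta>" unfolding X.centre_in_mball_iff using f(1,3) by (rule conjI)
      ultimately have "f \<in> U j" unfolding U_def by (rule UnionI)
      with 1 show ?thesis by blast
    qed
    then show ?thesis unfolding X.metric_closure_of by auto
  qed
  have "(INF f\<in>G. level_dim lower_box_dim f F) \<le> ereal \<beta>" if "G \<in> dense_gdeltas \<alpha> F" for G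
  proof -
    have G: "gdelta_in X.mtopology G" "X.mtopology closure_of G = mspace X"
      using that unfolding dense_gdeltas_def top[symmetric] by (simp_all only: mem_Collect_eq X_def)
    obtain \<U> where U': "countable \<U>" "\<U> \<subseteq> Collect (openin X.mtopology)" "\<Inter>\<U> = G"
      using G(1) unfolding gdelta_in_alt intersection_of_def by auto
    define \<T> where "\<T> = \<U> \<union> range U"
    have "X.mtopology closure_of \<Inter>\<T> = mspace X"
    proof (rule X.metric_Baire_category)
      show "X.mcomplete" unfolding X_def by (rule mcomplete_holder_space)
      show "countable \<T>" using U'(1) by (simp add: \<T>_def)
      fix T assume "T \<in> \<T>"
      then consider "T \<in> \<U>" | j where "T = U j" by (auto simp: \<T>_def)
      then show "openin X.mtopology T \<and> X.mtopology closure_of T = mspace X"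
      proof cases
        case 1
        then have "G \<subseteq> T" using U' by auto
        then have "mspace X \<subseteq> X.mtopology closure_of T" using closure_of_mono G(2) by blast
        moreover have "X.mtopology closure_of T \<subseteq> mspace X"
          using closure_of_subset_topspace by fastforce
        ultimately show ?thesis using 1 U' by auto
      qed (use U_open U_dense in auto)
    qed
    then have "\<Inter>\<T> \<noteq> {}" using ne unfolding X_def by auto
    then obtain f where f: "f \<in> \<Inter>\<T>" by blast
    then have "f \<in> G" "\<And>j. f \<in> U j" using U'(3) by (auto simp: \<T>_def)
    then show ?thesis using U_frugal \<beta> by (intro INF_lower2[of f] level_dim_le_of_frugal) auto
  qed
  then show ?thesis unfolding D_lower_box_star_def generic_level_dim_def by (rule SUP_least)
qed

section \<open>Choice of the block\<close>

text \<open>The \<open>n + 1\<close> terms in the expansion of \<open>(t + (1 - t)) ^ n\<close> have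
  sum \<open>1\<close>, increase up to the index \<open>k\<close> and decrease from there. The
  largest term is at least the average.\<close>

lemma binomial_max_term:
  fixes n k :: nat
  assumes k: "0 < k" "k < n"
  defines "t \<equiv> real k / real n"
  shows "1 \<le> real (n + 1) * (real (n choose k) * t ^ k * (1 - t) ^ (n - k))"
proof -
  define g where "g j = real (n choose j) * t ^ j * (1 - t) ^ (n - j)" for j
  have t: "0 < t" "t < 1" "real n * t = real k" using k by (auto simp: t_def)
  have g0: "0 \<le> g j" for j using t by (simp add: g_def)
  \<comment> \<open>The quotient of consecutive terms, cleared of denominators.\<close>
  have step: "g (Suc j) * (real (Suc j) * (1 - t)) = g j * (real (n - j) * t)" if "j < n" for j
  proof -
    have "Suc j * (n choose Suc j) = (n - j) * (n choose j)"
      using that by (metis binomial_absorb_comp binomial_absorption mult.commute)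
    then have c: "real (Suc j) * real (n choose Suc j) = real (n - j) * real (n choose j)"
      by (metis of_nat_mult)
    have p: "(1 - t) ^ (n - j) = (1 - t) * (1 - t) ^ (n - Suc j)"
      using that by (metis Suc_diff_Suc power_Suc)
    have "g (Suc j) * (real (Suc j) * (1 - t)) =
        (real (Suc j) * real (n choose Suc j)) * t ^ Suc j * ((1 - t) * (1 - t) ^ (n - Suc j))"
      unfolding g_def by (simp only: mult_ac)
    also have "\<dots> = g j * (real (n - j) * t)"
      unfolding c p[symmetric] g_def by (simp add: mult_ac)
    finally show ?thesis .
  qed
  have up: "g j \<le> g (Suc j)" if "j < k" for j
  proof -
    have "real (Suc j) * (1 - t) \<le> real (n - j) * t"
      using that k t by (simp add: of_nat_diff algebra_simps)
    then have "g j * (real (Suc j) * (1 - t)) \<le> g (Suc j) * (real (Suc j) * (1 - t))"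
      using step[of j] that k mult_left_mono[OF _ g0] by simp
    then show ?thesis using t by (simp add: mult_le_cancel_right)
  qed
  have down: "g (Suc j) \<le> g j" if "k \<le> j" "j < n" for j
  proof -
    have "real k + t \<le> real j + 1" using that t by simp
    then have "real (n - j) * t \<le> real (Suc j) * (1 - t)"
      using that t by (simp add: of_nat_diff algebra_simps)
    then have "g (Suc j) * (real (Suc j) * (1 - t)) \<le> g j * (real (Suc j) * (1 - t))"
      using step[of j] that mult_left_mono[OF _ g0] by simp
    then show ?thesis using t by (simp add: mult_le_cancel_right)
  qed
  have max: "g j \<le> g k" if "j \<le> n" for j
  proof (cases "j \<le> k")
    case True
    then show ?thesis by (induction rule: inc_induct) (auto intro: order_trans[OF up])
  next
    case False
    then have "k \<le> j" by simp
    then show ?thesis using that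
      by (induction rule: dec_induct) (auto intro: order_trans[OF down])
  qed
  have "1 = (t + (1 - t)) ^ n" by simp
  also have "\<dots> = (\<Sum>j\<le>n. g j)" unfolding binomial_ring g_def by simp
  also have "\<dots> \<le> (\<Sum>j\<le>n. g k)" by (intro sum_mono) (use max in auto)
  also have "\<dots> = real (n + 1) * g k" by simp
  finally show ?thesis unfolding g_def .
qed

text \<open>The entropy bound for binomial coefficients in logarithmic form. Since
  \<open>n * (1 + t) = n + k\<close>, the left side is \<open>sierpinski_h t\<close> times the
  number of levels taken by \<open>n\<close> moves with \<open>k\<close> downs.\<close>

lemma sierpinski_h_le_binomial:
  fixes n k :: nat
  assumes k: "0 < k" "k < n"
  defines "t \<equiv> real k / real n"
  shows "real n * (1 + t) * sierpinski_h t \<le> real k + log 2 (real (n choose k)) + log 2 (real (n + 1))"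
proof -
  have t: "0 < t" "t < 1" "real n * t = real k" using k by (auto simp: t_def)
  have c: "0 < real (n choose k)" using k by simp
  have "0 \<le> log 2 (real (n + 1) * (real (n choose k) * t ^ k * (1 - t) ^ (n - k)))"
    using binomial_max_term[OF k] unfolding t_def by simp
  also have "\<dots> = log 2 (real (n + 1)) + log 2 (real (n choose k)) + real k * log 2 t + real (n - k) * log 2 (1 - t)"
    using t c by (simp add: log_mult log_nat_power)
  finally have 1: "- real k * log 2 t - real (n - k) * log 2 (1 - t)
     \<le> log 2 (real (n choose k)) + log 2 (real (n + 1))" by simp
  have "real n * (1 + t) * sierpinski_h t = real n * (- (1 - t) * log 2 (1 - t) - t * log 2 t + t)"
    using t by (simp add: sierpinski_h_def)
  also have "\<dots> = - (real n - real n * t) * log 2 (1 - t) - real n * t * log 2 t + real n * t"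
    by (simp add: algebra_simps)
  also have "\<dots> = - real k * log 2 t - real (n - k) * log 2 (1 - t) + real k"
    unfolding t(3) using k by (simp add: of_nat_diff algebra_simps)
  finally show ?thesis using 1 by simp
qed

lemma sierpinski_h_inv:
  assumes "0 < \<alpha>" "\<alpha> \<le> 1"
  shows "sierpinski_h_inv \<alpha> \<in> {0<..1/2}" "sierpinski_h (sierpinski_h_inv \<alpha>) = \<alpha>"
proof -
  have \<alpha>: "\<alpha> \<in> {0<..1}" using assms by simp
  show "sierpinski_h_inv \<alpha> \<in> {0<..1/2}" unfolding sierpinski_h_inv_def
    using bij_betw_the_inv_into[OF bij_betw_sierpinski_h] \<alpha> by (rule bij_betwE[THEN bspec])
  show "sierpinski_h (sierpinski_h_inv \<alpha>) = \<alpha>" unfolding sierpinski_h_inv_def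
    using bij_betw_sierpinski_h \<alpha> by (rule f_the_inv_into_f_bij_betw)
qed

text \<open>If \<open>sierpinski_h t\<close> were at most \<open>\<alpha>\<close>, the intermediate
  value theorem between \<open>t\<close> and \<open>1 / 2\<close> would give a second point with
  value \<open>\<alpha>\<close>, against injectivity.\<close>

lemma sierpinski_h_gt:
  assumes "0 < \<alpha>" "\<alpha> < 1" "sierpinski_h_inv \<alpha> < t" "t < 1 / 2"
  shows "\<alpha> < sierpinski_h t"
proof (rule ccontr)
  define T where "T = sierpinski_h_inv \<alpha>"
  have bij: "bij_betw sierpinski_h {0<..1/2} {0<..1}" by (rule bij_betw_sierpinski_h)
  have inj: "inj_on sierpinski_h {0<..1/2}" using bij by (rule bij_betw_imp_inj_on)
  have T: "T \<in> {0<..1/2}" "sierpinski_h T = \<alpha>"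
    unfolding T_def using sierpinski_h_inv[of \<alpha>] assms by simp_all
  assume "\<not> \<alpha> < sierpinski_h t"
  moreover have "sierpinski_h (1 / 2) = 1" by (simp add: sierpinski_h_def log_divide)
  moreover have "continuous_on {t..1/2} sierpinski_h"
    unfolding sierpinski_h_def using T assms by (intro continuous_intros) (auto simp: T_def)
  ultimately obtain s where s: "t \<le> s" "s \<le> 1 / 2" "sierpinski_h s = \<alpha>"
    using IVT'[of sierpinski_h t \<alpha> "1/2"] assms by auto
  have "s = T" by (rule inj_onD[OF inj]) (use T s assms in \<open>auto simp: T_def\<close>)
  then show False using s assms by (simp add: T_def)
qed

lemma sierpinski_h_inv_bounds:
  assumes "0 < \<alpha>" "\<alpha> < 1"
  shows "0 < sierpinski_h_inv \<alpha>" "sierpinski_h_inv \<alpha> < 1 / 2"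
proof -
  define T where "T = sierpinski_h_inv \<alpha>"
  have T: "T \<in> {0<..1/2}" "sierpinski_h T = \<alpha>"
    unfolding T_def using sierpinski_h_inv[of \<alpha>] assms by simp_all
  have "sierpinski_h (1 / 2) = 1" by (simp add: sierpinski_h_def log_divide)
  then have "T \<noteq> 1 / 2" using T(2) assms(2) by (metis less_irrefl)
  then show "0 < sierpinski_h_inv \<alpha>" "sierpinski_h_inv \<alpha> < 1 / 2" using T(1) by (auto simp: T_def)
qed

text \<open>A rational \<open>t\<close> slightly above \<open>sierpinski_h_inv \<alpha>\<close>
  leaves a margin in the exponent. Writing \<open>t = k / n\<close> with a large common factor in
  \<open>k\<close> and \<open>n\<close> lets this margin absorb the logarithmic loss of the entropy
  bound.\<close>

lemma block_parameters:
  fixes \<alpha> \<beta> :: real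
  assumes \<alpha>: "0 < \<alpha>" "\<alpha> < 1" and \<beta>: "sierpinski_h_inv \<alpha> / (1 + sierpinski_h_inv \<alpha>) < \<beta>"
  obtains k l :: nat and \<beta>' :: real where "2 * k + 1 \<le> l"
    "2 powr (\<alpha> * l) \<le> 2 ^ k * real ((l - 1 - k) choose k)" "real k \<le> \<beta>' * l" "\<beta>' < \<beta>"
proof -
  define T where "T = sierpinski_h_inv \<alpha>"
  have T: "0 < T" "T < 1 / 2" unfolding T_def using sierpinski_h_inv_bounds[OF \<alpha>] by auto
  have "isCont (\<lambda>t. t / (1 + t)) T" using T by (intro continuous_intros) auto
  then have "((\<lambda>t. t / (1 + t)) \<longlongrightarrow> T / (1 + T)) (at_right T)"
    unfolding isCont_def by (rule tendsto_within_subset) simp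
  then have "eventually (\<lambda>t. t / (1 + t) < \<beta>) (at_right T)"
    using \<beta> unfolding T_def by (rule order_tendstoD(2))
  then obtain b where b: "T < b" "\<And>t. T < t \<Longrightarrow> t < b \<Longrightarrow> t / (1 + t) < \<beta>"
    unfolding eventually_at_right_field by blast
  obtain t where t: "t \<in> \<rat>" "T < t" "t < min b (1 / 2)"
    using Rats_dense_in_real[of T "min b (1/2)"] b T by auto
  have tb: "t / (1 + t) < \<beta>" and t0: "0 < t" "t < 1 / 2" using b t T by auto
  have ht: "\<alpha> < sierpinski_h t" using sierpinski_h_gt \<alpha> t t0 unfolding T_def by blast
  obtain p q :: nat where pq: "q \<noteq> 0" "t = real p / real q"
    using Rats_abs_nat_div_natE[OF t(1)] t0 by (metis abs_of_pos)
  have "0 < real p / real q" "real p / real q < 1" unfolding pq(2)[symmetric] using t0 by linarith+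
  then have p0: "0 < p" "p < q" using pq(1) by (auto simp: zero_less_divide_iff)
  \<comment> \<open>The margin per move: \<open>n * (1 + t) * sierpinski_h t\<close> exceeds
    \<open>\<alpha> * (n + k)\<close> by \<open>c * n\<close>. It has to cover
    \<open>log 2 (n + 1)\<close> and a further \<open>\<alpha>\<close> for the level set aside in
    \<open>budget_start\<close>.\<close>
  define c where "c = (1 + t) * (sierpinski_h t - \<alpha>)"
  have c: "0 < c" using t0 ht by (simp add: c_def)
  have "(\<lambda>n::nat. (log 2 (real n + 1) + \<alpha>) / real n) \<longlonglongrightarrow> 0" by real_asymp
  then have "eventually (\<lambda>n. (log 2 (real n + 1) + \<alpha>) / real n < c) sequentially"
    using c by (rule order_tendstoD(2))
  then obtain n0 where n0: "\<And>n. n \<ge> n0 \<Longrightarrow> (log 2 (real n + 1) + \<alpha>) / real n < c"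
    unfolding eventually_sequentially by auto
  define n where "n = q * Suc n0"
  define k where "k = p * Suc n0"
  have kn: "0 < k" "k < n"
    unfolding k_def n_def using p0 by (simp, intro mult_strict_right_mono) simp_all
  have t_eq: "t = real k / real n" unfolding pq k_def n_def by (simp del: of_nat_Suc mult_Suc_right)
  have "1 * Suc n0 \<le> n" unfolding n_def using pq by (intro mult_le_mono1) simp
  then have "(log 2 (real n + 1) + \<alpha>) / real n < c" by (intro n0) simp
  then have "log 2 (real n + 1) + \<alpha> \<le> c * real n" using kn by (simp add: field_simps)
  moreover have "real n * (1 + t) * sierpinski_h t \<le> real k + log 2 (real (n choose k)) + log 2 (real n + 1)"
    using sierpinski_h_le_binomial[OF kn] unfolding t_eq by (simp add: add_ac)
  moreover have "real n * (1 + t) = real n + real k" using kn unfolding t_eq by (simp add: field_simps)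
  ultimately have "\<alpha> * (real n + real k + 1) \<le> real k + log 2 (real (n choose k))"
    unfolding c_def by (simp add: algebra_simps)
  then have "2 powr (\<alpha> * (real n + real k + 1)) \<le> 2 powr (real k + log 2 (real (n choose k)))"
    by (intro powr_mono) auto
  also have "\<dots> = 2 ^ k * real (n choose k)" using kn by (simp add: powr_add powr_realpow)
  finally have M: "2 powr (\<alpha> * (real n + real k + 1)) \<le> 2 ^ k * real (n choose k)" .
  show thesis
  \<comment> \<open>The \<open>k\<close> downs take two levels each, the \<open>n - k\<close> ups
    one each, and one level is set aside.\<close>
  proof (rule that[of k "n + k + 1" "t / (1 + t)"])
    show "2 * k + 1 \<le> n + k + 1" using kn by simp
    show "2 powr (\<alpha> * real (n + k + 1)) \<le> 2 ^ k * real ((n + k + 1 - 1 - k) choose k)"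
      using M by (simp add: add_ac)
    have "real k = t * real n" using kn by (simp add: t_eq)
    also have "\<dots> = t / (1 + t) * (real n * (1 + t))" using t0 by simp
    also have "\<dots> \<le> t / (1 + t) * real (n + k + 1)"
      using t0 \<open>real n * (1 + t) = real n + real k\<close> by (intro mult_left_mono) auto
    finally show "real k \<le> t / (1 + t) * real (n + k + 1)" .
    show "t / (1 + t) < \<beta>" by (rule tb)
  qed
qed

section \<open>Approximation by Lipschitz functions\<close>

text \<open>The quotient of the minimum by its argument is nonincreasing, as it is for both
  functions; \<open>*\<close> says so without division, and subadditivity follows by summing over
  \<open>s\<close> and \<open>t\<close>.\<close>

lemma min_powr_linear_subadditive:
  fixes s t L \<alpha> :: real
  assumes "0 \<le> s" "0 \<le> t" "0 \<le> L" "0 < \<alpha>" "\<alpha> < 1"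
  shows "min ((s + t) powr \<alpha>) (L * (s + t)) \<le> min (s powr \<alpha>) (L * s) + min (t powr \<alpha>) (L * t)"
proof (cases "s = 0 \<or> t = 0")
  case True
  then show ?thesis using assms by (auto simp: min_def)
next
  case False
  define u where "u = s + t"
  define \<phi> where "\<phi> x = min (x powr \<alpha>) (L * x)" for x
  have u: "0 < u" using False assms by (simp add: u_def)
  have *: "x * \<phi> u \<le> u * \<phi> x" if x: "0 < x" "x \<le> u" for x
  proof -
    have p: "y powr \<alpha> = y * y powr (\<alpha> - 1)" if "0 < y" for y
      using that powr_mult_base[of y "\<alpha> - 1"] by simp
    have "u powr (\<alpha> - 1) \<le> x powr (\<alpha> - 1)" using x assms by (intro powr_mono2') auto
    then have "x * u powr \<alpha> \<le> u * x powr \<alpha>" using x u by (simp add: p)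
    moreover have "x * (L * u) = u * (L * x)" by simp
    moreover have "x * \<phi> u \<le> x * u powr \<alpha>" "x * \<phi> u \<le> x * (L * u)"
      using x by (auto simp: \<phi>_def intro!: mult_left_mono)
    moreover have "u * \<phi> x = u * x powr \<alpha> \<or> u * \<phi> x = u * (L * x)" by (auto simp: \<phi>_def min_def)
    ultimately show ?thesis by linarith
  qed
  have "u * \<phi> u = s * \<phi> u + t * \<phi> u" by (simp add: u_def algebra_simps)
  also have "\<dots> \<le> u * \<phi> s + u * \<phi> t"
    using *[of s] *[of t] False assms by (intro add_mono) (auto simp: u_def)
  finally have "u * \<phi> u \<le> u * (\<phi> s + \<phi> t)" by (simp add: algebra_simps)
  then show ?thesis using u by (simp add: \<phi>_def u_def)
qed

text \<open>
  The extension formula of McShane for the metric \<open>min (d^\<alpha>) (L d)\<close>.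
\<close>

lemma lipschitz_approximation:
  fixes F :: "'a::metric_space set" and f0 :: "'a \<Rightarrow> real"
  assumes \<alpha>: "0 < \<alpha>" "\<alpha> < 1" and \<kappa>: "0 < \<kappa>" and bnd: "\<And>x. x \<in> F \<Longrightarrow> \<bar>f0 x\<bar> \<le> K" and ne: "F \<noteq> {}"
    and f0: "\<And>x y. x \<in> F \<Longrightarrow> y \<in> F \<Longrightarrow> \<bar>f0 x - f0 y\<bar> \<le> dist x y powr \<alpha>"
  obtains L f where "0 \<le> L" "\<forall>x y. \<bar>f x - f y\<bar> \<le> L * dist x y" "\<forall>x y. \<bar>f x - f y\<bar> \<le> dist x y powr \<alpha>"
    "\<forall>x\<in>F. \<bar>f x - f0 x\<bar> \<le> \<kappa>"
proof -
  \<comment> \<open>At \<open>s0\<close> the power equals \<open>\<kappa>\<close> and the line of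
    slope \<open>L\<close> crosses it. Below \<open>s0\<close> the power is at most
    \<open>\<kappa>\<close>, and beyond it the minimum is the power itself.\<close>
  define s0 where "s0 = \<kappa> powr (1 / \<alpha>)"
  define L where "L = s0 powr (\<alpha> - 1)"
  have s0: "0 < s0" "s0 powr \<alpha> = \<kappa>" using \<kappa> \<alpha> by (auto simp: s0_def powr_powr)
  have L: "0 \<le> L" by (simp add: L_def)
  define \<phi> where "\<phi> x = min (x powr \<alpha>) (L * x)" for x :: real
  have \<phi>0: "0 \<le> \<phi> s" if "0 \<le> s" for s using that L by (simp add: \<phi>_def)
  have \<phi>_zero: "\<phi> 0 = 0" by (simp add: \<phi>_def)
  have \<phi>_mono: "\<phi> s \<le> \<phi> t" if "0 \<le> s" "s \<le> t" for s t
    using that L \<alpha> unfolding \<phi>_def by (intro min.mono mult_left_mono powr_mono2) auto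
  have \<phi>_add: "\<phi> (s + t) \<le> \<phi> s + \<phi> t" if "0 \<le> s" "0 \<le> t" for s t
    unfolding \<phi>_def using that L \<alpha> by (rule min_powr_linear_subadditive)
  have \<phi>_large: "s powr \<alpha> \<le> \<phi> s + \<kappa>" if "0 \<le> s" for s
  proof (cases "s < s0")
    case True
    then have "s powr \<alpha> \<le> s0 powr \<alpha>" using that \<alpha> by (intro powr_mono2) auto
    then show ?thesis using \<phi>0[OF that] s0 by simp
  next
    case False
    then have "s powr (\<alpha> - 1) \<le> L" unfolding L_def using s0 \<alpha> by (intro powr_mono2') auto
    then have "s * s powr (\<alpha> - 1) \<le> s * L" using that by (rule mult_left_mono)
    moreover have "s * s powr (\<alpha> - 1) = s powr \<alpha>" using False s0 powr_mult_base[of s "\<alpha> - 1"] by simp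
    ultimately have "\<phi> s = s powr \<alpha>" by (simp add: \<phi>_def mult.commute)
    then show ?thesis using \<kappa> by simp
  qed
  define f where "f x = (INF y\<in>F. f0 y + \<phi> (dist x y))" for x
  have bb: "bdd_below ((\<lambda>y. f0 y + \<phi> (dist x y)) ` F)" for x
  proof (rule bdd_belowI2)
    fix y assume "y \<in> F"
    then show "- K \<le> f0 y + \<phi> (dist x y)" using bnd[of y] \<phi>0[of "dist x y"] by (simp add: abs_le_iff)
  qed
  have f_le: "f x \<le> f x' + \<phi> (dist x x')" for x x'
  proof -
    have "f x - \<phi> (dist x x') \<le> f x'" unfolding f_def[of x']
    proof (rule cINF_greatest[OF ne])
      fix y assume y: "y \<in> F"
      have "f x \<le> f0 y + \<phi> (dist x y)" unfolding f_def using bb y by (rule cINF_lower)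
      also have "\<phi> (dist x y) \<le> \<phi> (dist x x' + dist x' y)" by (intro \<phi>_mono dist_triangle) auto
      also have "\<dots> \<le> \<phi> (dist x x') + \<phi> (dist x' y)" by (intro \<phi>_add) auto
      finally show "f x - \<phi> (dist x x') \<le> f0 y + \<phi> (dist x' y)" by simp
    qed
    then show ?thesis by simp
  qed
  have mod: "\<bar>f x - f x'\<bar> \<le> \<phi> (dist x x')" for x x'
    using f_le[of x x'] f_le[of x' x] by (simp add: dist_commute abs_le_iff)
  have close: "\<bar>f x - f0 x\<bar> \<le> \<kappa>" if x: "x \<in> F" for x
  proof -
    have "f x \<le> f0 x + \<phi> (dist x x)" unfolding f_def using bb x by (rule cINF_lower)
    then have 1: "f x \<le> f0 x" by (simp add: \<phi>_zero)
    have "f0 x - \<kappa> \<le> f x" unfolding f_def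
    proof (rule cINF_greatest[OF ne])
      fix y assume y: "y \<in> F"
      show "f0 x - \<kappa> \<le> f0 y + \<phi> (dist x y)" using f0[OF x y] \<phi>_large[of "dist x y"] by simp
    qed
    with 1 \<kappa> show ?thesis by simp
  qed
  have "\<forall>x y. \<bar>f x - f y\<bar> \<le> L * dist x y" "\<forall>x y. \<bar>f x - f y\<bar> \<le> dist x y powr \<alpha>"
    using mod unfolding \<phi>_def by simp_all
  moreover have "\<forall>x\<in>F. \<bar>f x - f0 x\<bar> \<le> \<kappa>" using close by blast
  ultimately show thesis by (rule that[OF L])
qed

text \<open>Multiplication by \<open>1 - e\<close> creates the slack used at coarse scales. The
  approximation is bounded by \<open>K + \<epsilon>\<close> on \<open>F\<close>, and
  \<open>e\<close> is chosen so that this changes it by at most \<open>\<epsilon> / 2\<close>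
  there.\<close>

lemma strict_lipschitz_approximation:
  fixes F :: "'a::metric_space set" and f0 :: "'a \<Rightarrow> real"
  assumes \<alpha>: "0 < \<alpha>" "\<alpha> < 1" and \<epsilon>: "0 < \<epsilon>" and bnd: "bounded (f0 ` F)"
    and f0: "\<And>x y. x \<in> F \<Longrightarrow> y \<in> F \<Longrightarrow> \<bar>f0 x - f0 y\<bar> \<le> dist x y powr \<alpha>"
  obtains e L f where "0 < e" "e \<le> 1" "\<forall>x y. \<bar>f x - f y\<bar> \<le> L * dist x y"
    "\<forall>x y. \<bar>f x - f y\<bar> \<le> (1 - e) * dist x y powr \<alpha>" "\<forall>x\<in>F. \<bar>f x - f0 x\<bar> \<le> \<epsilon>"
proof (cases "F = {}")
  case True
  then show thesis using that[of "1/2" "\<lambda>_. 0" 0] by simp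
next
  case False
  obtain K where K: "\<And>x. x \<in> F \<Longrightarrow> \<bar>f0 x\<bar> \<le> K" using bnd unfolding bounded_iff by auto
  obtain z where "z \<in> F" using False by blast
  then have K0: "0 \<le> K" using K[of z] by simp
  obtain L g where g: "0 \<le> L" "\<forall>x y. \<bar>g x - g y\<bar> \<le> L * dist x y" "\<forall>x y. \<bar>g x - g y\<bar> \<le> dist x y powr \<alpha>"
    "\<forall>x\<in>F. \<bar>g x - f0 x\<bar> \<le> \<epsilon> / 2"
    by (rule lipschitz_approximation[OF \<alpha> half_gt_zero[OF \<epsilon>] K False f0])
  define e where "e = min 1 (\<epsilon> / (2 * (K + \<epsilon>)))"
  have e: "0 < e" "e \<le> 1" using \<epsilon> K0 by (auto simp: e_def)
  have ee: "e * (K + \<epsilon>) \<le> \<epsilon> / 2"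
  proof -
    have "e * (K + \<epsilon>) \<le> \<epsilon> / (2 * (K + \<epsilon>)) * (K + \<epsilon>)" using \<epsilon> K0 by (intro mult_right_mono) (auto simp: e_def)
    also have "\<dots> = \<epsilon> / 2"
    proof -
      have *: "\<epsilon> / (2 * X) * X = \<epsilon> / 2" if "X \<noteq> 0" for X :: real using that by simp
      have "K + \<epsilon> \<noteq> 0" using \<epsilon> K0 by linarith
      then show ?thesis by (rule *)
    qed
    finally show ?thesis .
  qed
  define f where "f x = (1 - e) * g x" for x
  have f_diff: "\<bar>f x - f y\<bar> = (1 - e) * \<bar>g x - g y\<bar>" for x y
    using e by (simp add: f_def abs_mult flip: right_diff_distrib)
  have "(1 - e) * \<bar>g x - g y\<bar> \<le> 1 * (L * dist x y)" for x y using e g by (intro mult_mono) auto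
  then have 1: "\<forall>x y. \<bar>f x - f y\<bar> \<le> L * dist x y" unfolding f_diff by simp
  have 2: "\<forall>x y. \<bar>f x - f y\<bar> \<le> (1 - e) * dist x y powr \<alpha>"
    unfolding f_diff using e g by (intro allI mult_left_mono) auto
  have 3: "\<forall>x\<in>F. \<bar>f x - f0 x\<bar> \<le> \<epsilon>"
  proof
    fix x assume x: "x \<in> F"
    have gx: "\<bar>g x - f0 x\<bar> \<le> \<epsilon> / 2" using g(4) x by blast
    then have "\<bar>g x\<bar> \<le> K + \<epsilon>" using K[OF x] \<epsilon> by linarith
    then have "e * \<bar>g x\<bar> \<le> e * (K + \<epsilon>)" using e by (intro mult_left_mono) auto
    then have "e * \<bar>g x\<bar> \<le> \<epsilon> / 2" using ee by linarith
    then have "\<bar>e * g x\<bar> \<le> \<epsilon> / 2" using e by (simp add: abs_mult)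
    then have "\<bar>g x - e * g x - f0 x\<bar> \<le> \<epsilon>" using gx by linarith
    then show "\<bar>f x - f0 x\<bar> \<le> \<epsilon>" by (simp add: f_def left_diff_distrib)
  qed
  show thesis using e 1 2 3 by (rule that)
qed

section \<open>Assembly for the triangle\<close>

context equilateral
begin

text \<open>One half of \<open>\<epsilon>\<close> is spent on the Lipschitz approximation and the
  other on the construction over it. The exponent \<open>\<beta> + \<epsilon>\<close> allowed by
  \<open>frugal\<close> gives the strict inequality that \<open>block_parameters\<close> asks
  for.\<close>

lemma frugal_approximation_holder_space:
  assumes \<alpha>: "0 < \<alpha>" "\<alpha> < 1" and f0: "f0 \<in> mspace (holder_space \<alpha> \<Delta>)" and \<epsilon>: "0 < \<epsilon>"
  defines "\<beta> \<equiv> sierpinski_h_inv \<alpha> / (1 + sierpinski_h_inv \<alpha>)"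
  shows "\<exists>f \<eta>. f \<in> mspace (holder_space \<alpha> \<Delta>) \<and> (\<forall>x\<in>\<Delta>. \<bar>f x - f0 x\<bar> \<le> \<epsilon>) \<and> 0 < \<eta> \<and>
    (\<forall>g. (\<forall>x\<in>\<Delta>. \<bar>g x - f x\<bar> < \<eta>) \<longrightarrow> frugal \<Delta> \<beta> \<epsilon> g)"
proof -
  note space = mspace_holder_space[OF compact_sierpinski \<alpha>(1)]
  have f0_hol: "\<bar>f0 x - f0 y\<bar> \<le> dist x y powr \<alpha>" if "x \<in> \<Delta>" "y \<in> \<Delta>" for x y
    using f0 that unfolding space by blast
  have "f0 \<in> mspace (cfunspace (top_of_set \<Delta>) euclidean_metric)" using f0 holder_space_subset by blast
  then have bnd: "bounded (f0 ` \<Delta>)" by simp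
  have \<epsilon>2: "0 < \<epsilon> / 2" using \<epsilon> by simp
  obtain e L f1 where e: "0 < e" "e \<le> 1" and f1: "\<forall>x y. \<bar>f1 x - f1 y\<bar> \<le> L * dist x y"
    "\<forall>x y. \<bar>f1 x - f1 y\<bar> \<le> (1 - e) * dist x y powr \<alpha>" "\<forall>x\<in>\<Delta>. \<bar>f1 x - f0 x\<bar> \<le> \<epsilon> / 2"
    by (rule strict_lipschitz_approximation[OF \<alpha> \<epsilon>2 bnd f0_hol])
  have "\<beta> < \<beta> + \<epsilon>" using \<epsilon> by simp
  then obtain k l :: nat and \<beta>' :: real where kl: "2 * k + 1 \<le> l" "2 powr (\<alpha> * real l) \<le> 2 ^ k * real ((l - 1 - k) choose k)"
    "real k \<le> \<beta>' * real l" "\<beta>' < \<beta> + \<epsilon>"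
    unfolding \<beta>_def by (rule block_parameters[OF \<alpha>])
  obtain f \<delta> \<eta> B where f: "\<forall>x\<in>\<Delta>. \<forall>y\<in>\<Delta>. \<bar>f x - f y\<bar> \<le> dist x y powr \<alpha>"
    "\<forall>x\<in>\<Delta>. \<bar>f x - f1 x\<bar> \<le> \<epsilon> / 2"
    and \<delta>: "0 < \<delta>" "\<delta> < \<epsilon> / 2" and \<eta>: "0 < \<eta>"
    and B: "B \<in> sets lborel" "emeasure lborel B < ennreal (\<epsilon> / 2)"
    and cov: "\<forall>g. (\<forall>x\<in>\<Delta>. \<bar>g x - f x\<bar> < \<eta>) \<longrightarrow>
       (\<forall>r. r \<notin> B \<longrightarrow> real (covering_number \<delta> {x \<in> \<Delta>. g x = r}) \<le> \<delta> powr - (\<beta> + \<epsilon>))"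
    by (rule frugal_approximation[OF \<alpha> kl f1(1)[rule_format] e f1(2)[rule_format] \<epsilon>2])
  have B': "emeasure lborel B < ennreal \<epsilon>"
    using B(2) by (rule order_less_le_trans) (use \<epsilon> in \<open>simp add: ennreal_leI\<close>)
  show ?thesis
  proof (intro exI[of _ "restrict f \<Delta>"] exI[of _ \<eta>] conjI ballI allI impI)
    show "restrict f \<Delta> \<in> mspace (holder_space \<alpha> \<Delta>)"
      unfolding space using f(1) by simp
    show "\<bar>restrict f \<Delta> x - f0 x\<bar> \<le> \<epsilon>" if x: "x \<in> \<Delta>" for x
    proof -
      have "\<bar>f x - f0 x\<bar> \<le> \<epsilon>" using bspec[OF f(2) x] bspec[OF f1(3) x] by linarith
      then show ?thesis using x by simp
    qed
    show "0 < \<eta>" by (rule \<eta>)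
    show "frugal \<Delta> \<beta> \<epsilon> g" if g: "\<forall>x\<in>\<Delta>. \<bar>g x - restrict f \<Delta> x\<bar> < \<eta>" for g
    proof -
      have "\<forall>x\<in>\<Delta>. \<bar>g x - f x\<bar> < \<eta>" using g by simp
      then have "\<forall>r. r \<notin> B \<longrightarrow> real (covering_number \<delta> {x \<in> \<Delta>. g x = r}) \<le> \<delta> powr - (\<beta> + \<epsilon>)"
        by (rule cov[THEN spec, THEN mp])
      moreover have "\<delta> < \<epsilon>" using \<delta> by linarith
      ultimately show ?thesis using \<delta>(1) B(1) B' unfolding frugal_def by blast
    qed
  qed
qed

lemma D_lower_box_star_sierpinski_le:
  assumes \<alpha>: "0 < \<alpha>" "\<alpha> < 1"
  shows "D_lower_box_star \<alpha> \<Delta> \<le> ereal (sierpinski_h_inv \<alpha> / (1 + sierpinski_h_inv \<alpha>))"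
proof (rule D_lower_box_star_le)
  show "0 \<le> sierpinski_h_inv \<alpha> / (1 + sierpinski_h_inv \<alpha>)"
    using sierpinski_h_inv_bounds[OF \<alpha>] by simp
  have "restrict (\<lambda>_. 0) \<Delta> \<in> mspace (holder_space \<alpha> \<Delta>)"
    unfolding mspace_holder_space[OF compact_sierpinski \<alpha>(1)] by simp
  then show "mspace (holder_space \<alpha> \<Delta>) \<noteq> {}" by blast
qed (rule frugal_approximation_holder_space[OF \<alpha>])

end

theorem theorem4p2:
  fixes a b c :: "real ^ 2" and \<alpha> :: real
  assumes "dist a b = 1" "dist b c = 1" "dist a c = 1"
    and "0 < \<alpha>" "\<alpha> < 1"
  shows "D_star \<alpha> (sierpinski_triangle a b c) \<le> D_lower_box_star \<alpha> (sierpinski_triangle a b c) \<and>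
         D_lower_box_star \<alpha> (sierpinski_triangle a b c)
           \<le> ereal (sierpinski_h_inv \<alpha> / (1 + sierpinski_h_inv \<alpha>))"
proof
  interpret equilateral a b c using assms(1-3) by unfold_locales
  show "D_star \<alpha> \<Delta> \<le> D_lower_box_star \<alpha> \<Delta>"
    using compact_sierpinski by (intro D_star_le_D_lower_box_star compact_imp_bounded)
  show "D_lower_box_star \<alpha> \<Delta> \<le> ereal (sierpinski_h_inv \<alpha> / (1 + sierpinski_h_inv \<alpha>))"
    using assms(4,5) by (rule D_lower_box_star_sierpinski_le)
qed

end
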